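(* Let $S\subset\mathbf{R}^d$ be a Gutkin billiard table for the angle $\delta$, let $n(p)$ denote the unit inner normal to $S$ at $p$, and let $\gamma(s)$ be a geodesic of $S$ parametrized by arc length $s$. Put $z(s)=\cos\delta\,\dot\gamma(s)+\sin\delta\, n(\gamma(s))$ and let $\Gamma(s)\in S$ be the point with $\Gamma(s)-\gamma(s)=l(s)z(s)$, $l(s)>0$ (the other endpoint of the chord of $S$ from $\gamma(s)$ in direction $z(s)$). Then $\Gamma$ is a geodesic of $S$ for which $s$ is a regular parameter (not necessarily proportional to arc length), and moreover for every $s$: (1) the vectors $z(s),\dot\Gamma(s),\ddot\Gamma(s)$ lie in a 2-dimensional linear subspace; (2) the angle between $\dot\Gamma(s)$ and $z(s)$ equals $\delta$.
   Context: A Gutkin billiard table in $\mathbf{R}^d$ is a smooth closed hypersurface $S$ bounding a compact convex domain, with all principal curvatures strictly positive everywhere, for which there exists $\delta\in(0,\pi/2)$ such that for every pair of distinct points $p,q\in S$: if the angle between $\overrightarrow{pq}$ and the tangent hyperplane $T_pS$ equals $\delta$, then the angle between $\overrightarrow{pq}$ and $T_qS$ also equals $\delta$. *)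

theory Defs
  imports "HOL-Analysis.Analysis"
begin

fun iter_dd :: "'a::euclidean_space list \<Rightarrow> ('a \<Rightarrow> 'b::real_normed_vector) \<Rightarrow> 'a \<Rightarrow> 'b" where
  "iter_dd [] f = f"
| "iter_dd (v # vs) f = (\<lambda>x. frechet_derivative (iter_dd vs f) (at x) v)"

definition smooth_fun :: "('a::euclidean_space \<Rightarrow> 'b::real_normed_vector) \<Rightarrow> bool" where
  "smooth_fun f \<longleftrightarrow> (\<forall>vs x. iter_dd vs f differentiable (at x))"

definition grad :: "('a::euclidean_space \<Rightarrow> real) \<Rightarrow> 'a \<Rightarrow> 'a" where
  "grad F p = (\<Sum>b\<in>Basis. frechet_derivative F (at p) b *\<^sub>R b)"

text \<open>Unit inner normal of the hypersurface {F = 0}, F < 0 inside.\<close>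
definition inner_normal :: "('a::euclidean_space \<Rightarrow> real) \<Rightarrow> 'a \<Rightarrow> 'a" where
  "inner_normal F p = - (grad F p /\<^sub>R norm (grad F p))"

text \<open>F is a global smooth defining function of a smooth closed hypersurface S = {F = 0}
  bounding the compact convex domain {F \<le> 0}, with all principal curvatures strictly
  positive (second fundamental form positive definite on every tangent space).\<close>
definition convex_table_fun :: "('a::euclidean_space \<Rightarrow> real) \<Rightarrow> bool" where
  "convex_table_fun F \<longleftrightarrow>
     smooth_fun F \<and>
     {x. F x = 0} \<noteq> {} \<and>
     compact {x. F x \<le> 0} \<and> convex {x. F x \<le> 0} \<and>
     (\<forall>p. F p = 0 \<longrightarrow> grad F p \<noteq> 0) \<and>
     (\<forall>p v. F p = 0 \<longrightarrow> v \<noteq> 0 \<longrightarrow> v \<bullet> grad F p = 0 \<longrightarrow> iter_dd [v, v] F p > 0)"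

definition angle_hyperplane :: "'a::euclidean_space \<Rightarrow> 'a \<Rightarrow> real" where
  "angle_hyperplane w N = arcsin (\<bar>w \<bullet> N\<bar> / (norm w * norm N))"

definition vec_angle :: "'a::euclidean_space \<Rightarrow> 'a \<Rightarrow> real" where
  "vec_angle u v = arccos ((u \<bullet> v) / (norm u * norm v))"

definition gutkin_table :: "('a::euclidean_space \<Rightarrow> real) \<Rightarrow> real \<Rightarrow> bool" where
  "gutkin_table F \<delta> \<longleftrightarrow> convex_table_fun F \<and> 0 < \<delta> \<and> \<delta> < pi / 2 \<and>
     (\<forall>p q. F p = 0 \<longrightarrow> F q = 0 \<longrightarrow> p \<noteq> q \<longrightarrow>
        angle_hyperplane (q - p) (grad F p) = \<delta> \<longrightarrow> angle_hyperplane (q - p) (grad F q) = \<delta>)"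

abbreviation vd :: "(real \<Rightarrow> 'a::real_normed_vector) \<Rightarrow> real \<Rightarrow> 'a" where
  "vd c s \<equiv> vector_derivative c (at s)"

definition C2_curve_on :: "real set \<Rightarrow> (real \<Rightarrow> 'a::real_normed_vector) \<Rightarrow> bool" where
  "C2_curve_on J c \<longleftrightarrow> (\<forall>s\<in>J. (c has_vector_derivative vd c s) (at s) \<and>
       ((\<lambda>t. vd c t) has_vector_derivative vd (\<lambda>t. vd c t) s) (at s))"

definition geodesic_on :: "('a::euclidean_space \<Rightarrow> real) \<Rightarrow> real set \<Rightarrow> (real \<Rightarrow> 'a) \<Rightarrow> bool" where
  "geodesic_on F J c \<longleftrightarrow> open J \<and> is_interval J \<and> C2_curve_on J c \<and>
     (\<forall>s\<in>J. F (c s) = 0) \<and>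
     (\<forall>s\<in>J. \<exists>a. vd (\<lambda>t. vd c t) s = a *\<^sub>R grad F (c s))"

definition unit_speed_on :: "real set \<Rightarrow> (real \<Rightarrow> 'a::real_normed_vector) \<Rightarrow> bool" where
  "unit_speed_on J c \<longleftrightarrow> (\<forall>s\<in>J. norm (vd c s) = 1)"

text \<open>A geodesic for which the parameter is regular but not necessarily proportional to arc
  length: a regular C^2 curve which, after an orientation-preserving regular change of parameter,
  becomes an arc-length parametrized geodesic.\<close>
definition regular_geodesic_on :: "('a::euclidean_space \<Rightarrow> real) \<Rightarrow> real set \<Rightarrow> (real \<Rightarrow> 'a) \<Rightarrow> bool" where
  "regular_geodesic_on F J c \<longleftrightarrow> open J \<and> is_interval J \<and> C2_curve_on J c \<and>
     (\<forall>s\<in>J. F (c s) = 0) \<and> (\<forall>s\<in>J. vd c s \<noteq> 0) \<and>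
     (\<exists>J' \<phi>. bij_betw \<phi> J' J \<and> (\<forall>t\<in>J'. \<exists>d>0. (\<phi> has_real_derivative d) (at t)) \<and>
        geodesic_on F J' (c \<circ> \<phi>) \<and> unit_speed_on J' (c \<circ> \<phi>))"

end

theory Submission
  imports Defs
begin

text \<open>Let \<open>p\<close>, \<open>q\<close> be the endpoints of a chord of length \<open>l\<close> and direction
  \<open>z = cos \<delta> u + sin \<delta> n(p) = cos \<delta> U - sin \<delta> n(q)\<close>, with \<open>u\<close>, \<open>U\<close> unit tangent vectors at \<open>p\<close>, \<open>q\<close>. The angle
  at \<open>p\<close> is smaller than \<open>\<delta>\<close> iff the angle at \<open>q\<close> is: decreasing the angle at \<open>p\<close> to 0 shrinks
  the chord to the point \<open>p\<close>, and on the way the angle at \<open>q\<close> cannot pass through \<open>\<delta>\<close>. Hence at a chord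
  with angle \<open>\<delta>\<close> the differentials of the two angles on \<open>T\<^sub>pS \<times> T\<^sub>qS\<close> are proportional
  with a factor \<open>\<mu> > 0\<close>. Moving \<open>p\<close> along a geodesic with velocity \<open>u\<close>, the component of this
  proportionality in \<open>T\<^sub>pS\<close> yields \<open>q' = \<mu> U\<close>, and the component in \<open>T\<^sub>qS\<close> then shows that \<open>U'\<close> is
  normal to \<open>S\<close>. Finally \<open>\<mu> = 1 + l' / cos \<delta>\<close>, so \<open>s + l(s) / cos \<delta>\<close> is arc length on the image
  geodesic.\<close>

section \<open>Gradient and Hessian of a smooth function\<close>

lemma smooth_fun_has_derivative:
  assumes "smooth_fun F"
  shows "(F has_derivative (\<lambda>v. grad F x \<bullet> v)) (at x)"
proof -
  have d: "(F has_derivative frechet_derivative F (at x)) (at x)"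
    using assms unfolding smooth_fun_def frechet_derivative_works[symmetric]
    by (auto dest: spec[of _ "[]"])
  interpret bounded_linear "frechet_derivative F (at x)" using d by (rule has_derivative_bounded_linear)
  have "frechet_derivative F (at x) v = grad F x \<bullet> v" for v
  proof -
    have "frechet_derivative F (at x) v = frechet_derivative F (at x) (\<Sum>b\<in>Basis. (v \<bullet> b) *\<^sub>R b)"
      by (simp add: euclidean_representation)
    also have "\<dots> = (\<Sum>b\<in>Basis. (v \<bullet> b) * frechet_derivative F (at x) b)"
      by (simp add: sum scaleR)
    also have "\<dots> = grad F x \<bullet> v"
      by (auto simp: grad_def inner_sum_left inner_sum_right inner_commute mult.commute intro!: sum.cong)
    finally show ?thesis .
  qed
  then have "frechet_derivative F (at x) = (\<lambda>v. grad F x \<bullet> v)" by (rule ext)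
  then show ?thesis using d by simp
qed

lemma frechet_derivative_eq_grad:
  assumes "smooth_fun F"
  shows "frechet_derivative F (at x) v = grad F x \<bullet> v"
  using frechet_derivative_at[OF smooth_fun_has_derivative[OF assms]] by (simp add: fun_eq_iff)

abbreviation hess :: "('a::euclidean_space \<Rightarrow> real) \<Rightarrow> 'a \<Rightarrow> 'a \<Rightarrow> 'a" where
  "hess F x \<equiv> frechet_derivative (grad F) (at x)"

lemma grad_has_derivative:
  assumes "smooth_fun F"
  shows "(grad F has_derivative hess F x) (at x)"
proof -
  have "(\<lambda>y. frechet_derivative F (at y) b) differentiable (at x)" for b
    using assms unfolding smooth_fun_def by (auto dest: spec[of _ "[b]"])
  then have "grad F differentiable (at x)"
    unfolding grad_def[abs_def] by (intro differentiable_sum differentiable_scaleR) auto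
  then show ?thesis using frechet_derivative_works by blast
qed

text \<open>\<open>iter_dd\<close> applies the head of its list last, so the derivative in direction
  \<open>w\<close> is taken first. This turns the curvature hypothesis into positivity of the
  quadratic form of \<open>hess\<close>.\<close>

lemma inner_hess:
  assumes "smooth_fun F"
  shows "hess F x v \<bullet> w = iter_dd [v, w] F x"
proof -
  have "((\<lambda>y. frechet_derivative F (at y) w) has_derivative (\<lambda>v. hess F x v \<bullet> w)) (at x)"
    unfolding frechet_derivative_eq_grad[OF assms]
    by (rule has_derivative_inner_left[OF grad_has_derivative[OF assms]])
  from frechet_derivative_at[OF this] show ?thesis by (simp add: fun_eq_iff)
qed

lemma hess_differentiable:
  assumes "smooth_fun F"
  shows "(\<lambda>x. hess F x v) differentiable (at x)"
proof -
  have "(\<lambda>y. iter_dd [v, b] F y) differentiable (at x)" for b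
    using assms unfolding smooth_fun_def by blast
  then have "(\<lambda>y. \<Sum>b\<in>Basis. iter_dd [v, b] F y *\<^sub>R b) differentiable (at x)"
    by (intro differentiable_sum differentiable_scaleR) auto
  moreover have "(\<Sum>b\<in>Basis. iter_dd [v, b] F y *\<^sub>R b) = hess F y v" for y
    unfolding inner_hess[OF assms, symmetric] by (rule euclidean_representation)
  ultimately show ?thesis by simp
qed

lemma linear_hess: "smooth_fun F \<Longrightarrow> linear (hess F x)"
  using grad_has_derivative has_derivative_linear by blast

lemma fun_along_curve:
  assumes "smooth_fun F" "(c has_vector_derivative v) (at t)"
  shows "((\<lambda>t. F (c t)) has_real_derivative grad F (c t) \<bullet> v) (at t)"
  using has_derivative_compose[OF assms(2)[unfolded has_vector_derivative_def]
      smooth_fun_has_derivative[OF assms(1)]]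
  unfolding has_field_derivative_def by (simp add: mult.commute[of _ "grad F (c t) \<bullet> v"])

lemma grad_along_curve:
  assumes "smooth_fun F" "(c has_vector_derivative v) (at t)"
  shows "((\<lambda>t. grad F (c t)) has_vector_derivative hess F (c t) v) (at t)"
  using has_derivative_compose[OF assms(2)[unfolded has_vector_derivative_def]
      grad_has_derivative[OF assms(1)]]
  unfolding has_vector_derivative_def by (simp add: linear_cmul[OF linear_hess[OF assms(1)]])

lemma has_vector_derivative_affine:
  "((\<lambda>a. x + a *\<^sub>R v + y) has_vector_derivative v) (at t)"
  "((\<lambda>a. x + a *\<^sub>R v) has_vector_derivative v) (at t)"
  by (auto intro!: derivative_eq_intros)

text \<open>The mean value theorem is applied twice, first in direction \<open>v\<close> to the
  difference over \<open>t *\<^sub>R w\<close>, then in direction \<open>w\<close> to the resulting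
  difference of gradients. Division by \<open>t * t\<close> then isolates one Hessian value near
  \<open>x\<close>.\<close>

lemma second_difference_mean_value:
  assumes F: "smooth_fun F" and "t > 0"
  shows "\<exists>a b. 0 < a \<and> a < t \<and> 0 < b \<and> b < t \<and>
    F (x + t *\<^sub>R v + t *\<^sub>R w) - F (x + t *\<^sub>R v) - F (x + t *\<^sub>R w) + F x =
      t * t * (hess F (x + a *\<^sub>R v + b *\<^sub>R w) w \<bullet> v)"
proof -
  let ?f = "\<lambda>a. F (x + a *\<^sub>R v + t *\<^sub>R w) - F (x + a *\<^sub>R v)"
  let ?f' = "\<lambda>a. grad F (x + a *\<^sub>R v + t *\<^sub>R w) \<bullet> v - grad F (x + a *\<^sub>R v) \<bullet> v"
  have "\<exists>a>0. a < t \<and> ?f t - ?f 0 = (t - 0) * ?f' a"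
  proof (rule MVT2[OF \<open>t > 0\<close>])
    fix a
    show "DERIV ?f a :> ?f' a"
      by (intro DERIV_diff fun_along_curve F has_vector_derivative_affine)
  qed
  then obtain a where a: "0 < a" "a < t" "?f t - ?f 0 = t * ?f' a" by auto
  let ?g = "\<lambda>b. grad F (x + a *\<^sub>R v + b *\<^sub>R w) \<bullet> v"
  let ?g' = "\<lambda>b. hess F (x + a *\<^sub>R v + b *\<^sub>R w) w \<bullet> v"
  have "\<exists>b>0. b < t \<and> ?g t - ?g 0 = (t - 0) * ?g' b"
  proof (rule MVT2[OF \<open>t > 0\<close>])
    fix b
    show "DERIV ?g b :> ?g' b"
      using bounded_linear.has_vector_derivative[OF bounded_linear_inner_left
        grad_along_curve[OF F has_vector_derivative_affine(2)]]
      by (simp add: has_real_derivative_iff_has_vector_derivative)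
  qed
  then obtain b where "0 < b" "b < t" "?g t - ?g 0 = t * ?g' b" by auto
  with a show ?thesis by (intro exI[of _ a] exI[of _ b]) (simp add: algebra_simps)
qed

lemma second_difference_tendsto:
  assumes F: "smooth_fun F"
  shows "((\<lambda>t. (F (x + t *\<^sub>R v + t *\<^sub>R w) - F (x + t *\<^sub>R v) - F (x + t *\<^sub>R w) + F x) / (t * t))
    \<longlongrightarrow> hess F x w \<bullet> v) (at_right 0)"
proof -
  obtain a b where ab: "\<And>t. t > 0 \<Longrightarrow> 0 < a t \<and> a t < t \<and> 0 < b t \<and> b t < t \<and>
    F (x + t *\<^sub>R v + t *\<^sub>R w) - F (x + t *\<^sub>R v) - F (x + t *\<^sub>R w) + F x =
      t * t * (hess F (x + a t *\<^sub>R v + b t *\<^sub>R w) w \<bullet> v)"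
    using second_difference_mean_value[OF F, of _ x v w] by metis
  have pos: "\<forall>\<^sub>F t in at_right 0. (t::real) > 0" by (simp add: eventually_at_right_less)
  have lim: "(c \<longlongrightarrow> 0) (at_right 0)" if "\<And>t. t > 0 \<Longrightarrow> 0 < c t \<and> c t < t" for c :: "real \<Rightarrow> real"
    by (rule tendsto_sandwich[OF _ _ tendsto_const tendsto_ident_at])
      (use that in \<open>auto intro!: eventually_mono[OF pos] less_imp_le\<close>)
  have lx: "((\<lambda>t. x + a t *\<^sub>R v + b t *\<^sub>R w) \<longlongrightarrow> x + 0 *\<^sub>R v + 0 *\<^sub>R w) (at_right 0)"
    using ab by (intro tendsto_intros lim) auto
  have "isCont (\<lambda>y. hess F y w) x"
    using hess_differentiable[OF F] differentiable_imp_continuous_within by blast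
  then have "((\<lambda>t. hess F (x + a t *\<^sub>R v + b t *\<^sub>R w) w \<bullet> v) \<longlongrightarrow> hess F x w \<bullet> v) (at_right 0)"
    using lx by (intro tendsto_inner tendsto_const) (auto intro: isCont_tendsto_compose)
  then show ?thesis
  proof (rule Lim_transform_eventually, intro eventually_mono[OF pos])
    fix t :: real assume t: "t > 0"
    show "hess F (x + a t *\<^sub>R v + b t *\<^sub>R w) w \<bullet> v =
      (F (x + t *\<^sub>R v + t *\<^sub>R w) - F (x + t *\<^sub>R v) - F (x + t *\<^sub>R w) + F x) / (t * t)"
      unfolding conjunct2[OF conjunct2[OF conjunct2[OF conjunct2[OF ab[OF t]]]]] using t by simp
  qed
qed

text \<open>Both Hessian values are limits of one second difference, which does not change when
  \<open>v\<close> and \<open>w\<close> are exchanged.\<close>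

lemma hess_symmetric:
  assumes F: "smooth_fun F"
  shows "hess F x v \<bullet> w = hess F x w \<bullet> v"
proof -
  have eq: "(\<lambda>t. (F (x + t *\<^sub>R v + t *\<^sub>R w) - F (x + t *\<^sub>R v) - F (x + t *\<^sub>R w) + F x) / (t * t)) =
    (\<lambda>t. (F (x + t *\<^sub>R w + t *\<^sub>R v) - F (x + t *\<^sub>R w) - F (x + t *\<^sub>R v) + F x) / (t * t))"
    by (simp add: add.assoc add.commute add.left_commute diff_diff_eq)
  show ?thesis
    using tendsto_unique[OF trivial_limit_at_right_real second_difference_tendsto[OF F, of x w v]
      second_difference_tendsto[OF F, of x v w, unfolded eq]] .
qed

section \<open>Chords of a strictly convex hypersurface\<close>

locale convex_table =
  fixes F :: "'a::euclidean_space \<Rightarrow> real"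
  assumes table: "convex_table_fun F"
begin

lemma smooth: "smooth_fun F"
  and compact_body: "compact {x. F x \<le> 0}"
  and convex_body: "convex {x. F x \<le> 0}"
  and grad_nonzero: "F p = 0 \<Longrightarrow> grad F p \<noteq> 0"
  and hess_pos: "F p = 0 \<Longrightarrow> v \<noteq> 0 \<Longrightarrow> v \<bullet> grad F p = 0 \<Longrightarrow> hess F p v \<bullet> v > 0"
  using table unfolding convex_table_fun_def by (auto simp: inner_hess)

lemma isCont_F: "isCont F x"
  using smooth_fun_has_derivative[OF smooth] has_derivative_continuous by blast

lemma isCont_grad: "isCont (grad F) x"
  using grad_has_derivative[OF smooth] has_derivative_continuous by blast

text \<open>Strict convexity: otherwise \<open>F\<close> would become positive just after leaving
  \<open>y\<close> towards \<open>k\<close>, by the sign of its derivative or, in a tangent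
  direction, by positive curvature, while convexity of the domain keeps \<open>F\<close> nonpositive
  on the segment.\<close>

lemma grad_inner_chord_neg:
  assumes y: "F y = 0" and k: "F k \<le> 0" and "k \<noteq> y"
  shows "grad F y \<bullet> (k - y) < 0"
proof (rule ccontr)
  let ?d = "k - y"
  let ?f = "\<lambda>t. F (y + t *\<^sub>R ?d)"
  let ?f' = "\<lambda>t. grad F (y + t *\<^sub>R ?d) \<bullet> ?d"
  assume "\<not> grad F y \<bullet> ?d < 0"
  then have ge: "grad F y \<bullet> ?d \<ge> 0" by simp
  have f_le: "?f t \<le> 0" if "0 \<le> t" "t \<le> 1" for t
  proof -
    have "(1 - t) *\<^sub>R y + t *\<^sub>R k \<in> {x. F x \<le> 0}"
      using that y k by (intro convexD[OF convex_body]) auto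
    then show ?thesis by (simp add: algebra_simps)
  qed
  have df: "(?f has_real_derivative ?f' t) (at t)" for t
    by (intro fun_along_curve smooth has_vector_derivative_affine)
  have "\<exists>e>0. \<forall>h>0. h < e \<longrightarrow> 0 < ?f' h"
  proof (cases "grad F y \<bullet> ?d = 0")
    case True
    have d2: "(?f' has_real_derivative hess F (y + 0 *\<^sub>R ?d) ?d \<bullet> ?d) (at 0)"
      unfolding has_real_derivative_iff_has_vector_derivative
      by (intro bounded_linear.has_vector_derivative[OF bounded_linear_inner_left]
        grad_along_curve smooth has_vector_derivative_affine)
    have "hess F (y + 0 *\<^sub>R ?d) ?d \<bullet> ?d > 0"
      using True hess_pos[OF y, of ?d] \<open>k \<noteq> y\<close> by (simp add: inner_commute)
    from DERIV_pos_inc_right[OF d2 this] show ?thesis using True by simp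
  next
    case False
    with ge have pos: "?f' 0 > 0" by simp
    have "isCont ?f' 0"
      by (intro continuous_intros isCont_o2[OF _ isCont_grad])
    from this[unfolded isCont_def, THEN order_tendstoD(1), OF pos]
    show ?thesis unfolding eventually_at by (auto simp: dist_real_def)
  qed
  then obtain e where e: "e > 0" "\<And>h. 0 < h \<Longrightarrow> h < e \<Longrightarrow> 0 < ?f' h" by auto
  \<comment> \<open>Small enough for \<open>?f'\<close> to be positive on the way to
    \<open>h\<close>, and at most 1 so that the point stays on the segment.\<close>
  define h where "h = min (e / 2) 1"
  have h: "0 < h" "h < e" "h \<le> 1" using e(1) by (auto simp: h_def min_def)
  obtain \<xi> where "0 < \<xi>" "\<xi> < h" "?f h - ?f 0 = (h - 0) * ?f' \<xi>"
    using MVT2[OF h(1), of ?f ?f'] df by blast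
  moreover have "?f' \<xi> > 0" using e(2)[of \<xi>] calculation h by linarith
  ultimately have "?f h > 0" using y h by simp
  with f_le[of h] h show False by linarith
qed

text \<open>Strict convexity at the far endpoint, looking back at \<open>x\<close>. This
  transversality is the nondegeneracy behind the regular dependence of chords on parameters.\<close>

lemma chord_end_grad_pos:
  assumes "F x = 0" "F (x + r *\<^sub>R w) = 0" "r > 0" "w \<noteq> 0"
  shows "grad F (x + r *\<^sub>R w) \<bullet> w > 0"
proof -
  have "grad F (x + r *\<^sub>R w) \<bullet> (x - (x + r *\<^sub>R w)) < 0"
    using assms by (intro grad_inner_chord_neg) auto
  then show ?thesis using assms by (simp add: zero_less_mult_iff)
qed

text \<open>At the nearer of two hits the gradient would be positive along \<open>w\<close> as seen
  from \<open>x\<close>, but negative as seen from the farther hit.\<close>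

lemma chord_unique:
  assumes x: "F x = 0" and "w \<noteq> 0"
    and r: "F (x + r *\<^sub>R w) = 0" "r > 0" and r': "F (x + r' *\<^sub>R w) = 0" "r' > 0"
  shows "r = r'"
proof -
  have False if "F (x + a *\<^sub>R w) = 0" "a > 0" "F (x + b *\<^sub>R w) = 0" "a < b" for a b
  proof -
    have "grad F (x + a *\<^sub>R w) \<bullet> ((x + b *\<^sub>R w) - (x + a *\<^sub>R w)) < 0"
      using that \<open>w \<noteq> 0\<close> by (intro grad_inner_chord_neg) auto
    then have "(b - a) * (grad F (x + a *\<^sub>R w) \<bullet> w) < 0"
      by (simp add: inner_diff_right left_diff_distrib)
    with that chord_end_grad_pos[OF x that(1,2) \<open>w \<noteq> 0\<close>] show False
      by (simp add: mult_less_0_iff)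
  qed
  with r r' show ?thesis by (meson linorder_less_linear)
qed

section \<open>Existence and regularity of the second endpoint of a chord\<close>

lemma ray_hits:
  assumes p: "F p = 0" and w: "grad F p \<bullet> w < 0"
  shows "\<exists>r>0. F (p + r *\<^sub>R w) = 0"
proof -
  have w0: "w \<noteq> 0" using w by auto
  let ?f = "\<lambda>t. F (p + t *\<^sub>R w)"
  have "(?f has_real_derivative grad F (p + 0 *\<^sub>R w) \<bullet> w) (at 0)"
    by (intro fun_along_curve smooth has_vector_derivative_affine)
  from DERIV_neg_dec_right[OF this] w p obtain d where d: "d > 0" "\<And>h. 0 < h \<Longrightarrow> h < d \<Longrightarrow> ?f h < 0"
    by auto
  obtain B where B: "\<And>x. F x \<le> 0 \<Longrightarrow> norm x \<le> B"
    using compact_imp_bounded[OF compact_body] by (auto simp: bounded_iff)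
  \<comment> \<open>The first term moves the point at parameter \<open>R\<close> out of the ball of
    radius \<open>B\<close>; the added \<open>d\<close> keeps \<open>R\<close> to the right of
    \<open>d / 2\<close>, where \<open>F\<close> is negative.\<close>
  define R where "R = (\<bar>B\<bar> + norm p + 1) / norm w + d"
  have "(\<bar>B\<bar> + norm p + 1) / norm w > 0" using w0 by (simp add: add_nonneg_pos)
  then have "R > d" by (simp add: R_def)
  have "R * norm w = \<bar>B\<bar> + norm p + 1 + d * norm w"
    using w0 by (simp add: R_def distrib_right[of _ d])
  moreover have "d * norm w > 0" using d(1) w0 by simp
  ultimately have "R * norm w > B + norm p" by linarith
  note R = \<open>R > d\<close> this
  have "F (p + R *\<^sub>R w) > 0"
  proof (rule ccontr)
    assume "\<not> F (p + R *\<^sub>R w) > 0"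
    then have "norm (p + R *\<^sub>R w) \<le> B" using B by force
    moreover have "norm (R *\<^sub>R w) \<le> norm (p + R *\<^sub>R w) + norm p"
      using norm_triangle_ineq4[of "p + R *\<^sub>R w" p] by simp
    ultimately show False using R d by simp
  qed
  moreover have "isCont ?f t" for t
    by (intro isCont_o2[OF _ isCont_F] continuous_intros)
  moreover have "?f (d / 2) < 0" using d(2)[of "d / 2"] d(1) by simp
  ultimately obtain r where "d / 2 \<le> r" "?f r = 0"
    using IVT[of ?f "d / 2" 0 R] R(1) d(1) by auto
  then show ?thesis using d(1) by (intro exI[of _ r]) auto
qed

text \<open>By transversality \<open>F\<close> is negative at \<open>r0 - h\<close> and positive at
  \<open>r0 + h\<close> on the ray for \<open>t0\<close>. Both signs persist for nearby
  \<open>t\<close>, and the intermediate value theorem gives a root between.\<close>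

lemma chord_exists_near:
  assumes "isCont x t0" "isCont w t0" and x0: "F (x t0) = 0" and w0: "w t0 \<noteq> 0"
    and r0: "r0 > 0" "F (x t0 + r0 *\<^sub>R w t0) = 0" and "e > 0"
  shows "\<forall>\<^sub>F t in nhds t0. \<exists>r>0. \<bar>r - r0\<bar> < e \<and> F (x t + r *\<^sub>R w t) = (0::real)"
proof -
  let ?f = "\<lambda>r. F (x t0 + r *\<^sub>R w t0)"
  have df: "(?f has_real_derivative grad F (x t0 + r0 *\<^sub>R w t0) \<bullet> w t0) (at r0)"
    by (intro fun_along_curve smooth has_vector_derivative_affine)
  have pos: "grad F (x t0 + r0 *\<^sub>R w t0) \<bullet> w t0 > 0"
    using x0 w0 r0 by (intro chord_end_grad_pos)
  obtain d1 where d1: "d1 > 0" "\<And>h. 0 < h \<Longrightarrow> h < d1 \<Longrightarrow> 0 < ?f (r0 + h)"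
    using DERIV_pos_inc_right[OF df pos] r0 by auto
  obtain d2 where d2: "d2 > 0" "\<And>h. 0 < h \<Longrightarrow> h < d2 \<Longrightarrow> ?f (r0 - h) < 0"
    using DERIV_pos_inc_left[OF df pos] r0 by auto
  define h where "h = min (min d1 d2) (min e r0) / 2"
  have h: "h > 0" "h < d1" "h < d2" "h < e" "h < r0"
    using d1(1) d2(1) r0(1) \<open>e > 0\<close> unfolding h_def by linarith+
  have cont: "((\<lambda>t. F (x t + a *\<^sub>R w t)) \<longlongrightarrow> ?f a) (nhds t0)" for a
    using assms(1,2) isCont_F
    by (intro isCont_tendsto_compose[OF isCont_F] tendsto_intros) (auto simp: continuous_at tendsto_nhds_iff)
  have "\<forall>\<^sub>F t in nhds t0. F (x t + (r0 + h) *\<^sub>R w t) > 0" "\<forall>\<^sub>F t in nhds t0. F (x t + (r0 - h) *\<^sub>R w t) < 0"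
    using order_tendstoD[OF cont] d1(2) d2(2) h by auto
  then show ?thesis
  proof eventually_elim
    case (elim t)
    have "isCont (\<lambda>r. F (x t + r *\<^sub>R w t)) r" for r
      by (intro isCont_o2[OF _ isCont_F] continuous_intros)
    then obtain r where "r0 - h \<le> r" "r \<le> r0 + h" "F (x t + r *\<^sub>R w t) = 0"
      using IVT[of "\<lambda>r. F (x t + r *\<^sub>R w t)" "r0 - h" 0 "r0 + h"] elim h by auto
    with h show ?case by (intro exI[of _ r]) auto
  qed
qed

text \<open>Nearby roots exist within any tolerance of \<open>r t0\<close>, and uniqueness of the
  second endpoint identifies them with \<open>r t\<close>.\<close>

lemma chord_length_isCont:
  assumes "isCont x t0" "isCont w t0" and w0: "w t0 \<noteq> 0"
    and r: "\<forall>\<^sub>F t in nhds t0. F (x t) = 0 \<and> r t > 0 \<and> F (x t + r t *\<^sub>R w t) = 0"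
  shows "isCont r t0"
proof -
  have at0: "F (x t0) = 0" "r t0 > 0" "F (x t0 + r t0 *\<^sub>R w t0) = 0"
    using eventually_nhds_x_imp_x[OF r] by auto
  have w_ne: "\<forall>\<^sub>F t in nhds t0. w t \<noteq> 0"
    using assms(2) w0 by (auto simp: continuous_at tendsto_nhds_iff intro: tendsto_imp_eventually_ne)
  have "(r \<longlongrightarrow> r t0) (nhds t0)"
  proof (rule tendstoI)
    fix e :: real assume "e > 0"
    from chord_exists_near[OF assms(1,2) at0(1) w0 at0(2,3) this] r w_ne
    show "\<forall>\<^sub>F t in nhds t0. dist (r t) (r t0) < e"
      by eventually_elim (metis chord_unique dist_real_def)
  qed
  then show ?thesis by (simp add: continuous_at tendsto_nhds_iff)
qed

text \<open>The mean value theorem for either order of \<open>r\<close> and \<open>r0\<close>; the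
  bound on \<rho> makes it converge to \<open>r0\<close> together with \<open>r\<close>.\<close>

lemma radial_mean_value:
  "\<exists>\<rho>. \<bar>\<rho> - r0\<bar> \<le> \<bar>r - r0\<bar> \<and>
    F (y + r *\<^sub>R w) - F (y + r0 *\<^sub>R w) = (r - r0) * (grad F (y + \<rho> *\<^sub>R w) \<bullet> w)"
proof -
  have d: "((\<lambda>t. F (y + t *\<^sub>R w)) has_real_derivative grad F (y + t *\<^sub>R w) \<bullet> w) (at t)" for t
    by (intro fun_along_curve smooth has_vector_derivative_affine)
  consider "r < r0" | "r = r0" | "r > r0" by linarith
  then show ?thesis
  proof cases
    case 1
    from MVT2[OF this d] obtain z where "r < z" "z < r0"
      "F (y + r0 *\<^sub>R w) - F (y + r *\<^sub>R w) = (r0 - r) * (grad F (y + z *\<^sub>R w) \<bullet> w)" by blast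
    then show ?thesis by (intro exI[of _ z]) (auto simp: algebra_simps)
  next
    case 3
    from MVT2[OF this d] obtain z where "r0 < z" "z < r"
      "F (y + r *\<^sub>R w) - F (y + r0 *\<^sub>R w) = (r - r0) * (grad F (y + z *\<^sub>R w) \<bullet> w)" by blast
    then show ?thesis by (intro exI[of _ z]) auto
  qed auto
qed

text \<open>Implicit differentiation by hand: the increment of \<open>r\<close> is minus
  \<open>F (x t + r t0 *\<^sub>R w t)\<close> divided by a radial derivative, which tends to a
  positive number by transversality.\<close>

lemma chord_length_differentiable:
  assumes x: "(x has_vector_derivative x') (at t0)" and w: "(w has_vector_derivative w') (at t0)"
    and w0: "w t0 \<noteq> 0"
    and r: "\<forall>\<^sub>F t in nhds t0. F (x t) = 0 \<and> r t > 0 \<and> F (x t + r t *\<^sub>R w t) = 0"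
  shows "\<exists>r'. (r has_real_derivative r') (at t0)"
proof -
  have cx: "isCont x t0" and cw: "isCont w t0"
    using x w has_vector_derivative_continuous by blast+
  have at0: "F (x t0) = 0" "r t0 > 0" "F (x t0 + r t0 *\<^sub>R w t0) = 0"
    using eventually_nhds_x_imp_x[OF r] by auto
  have cr: "(r \<longlongrightarrow> r t0) (at t0)"
    using chord_length_isCont[OF cx cw w0 r] by (simp add: isCont_def)
  obtain \<rho> where \<rho>: "\<And>t. \<bar>\<rho> t - r t0\<bar> \<le> \<bar>r t - r t0\<bar>"
    "\<And>t. F (x t + r t *\<^sub>R w t) - F (x t + r t0 *\<^sub>R w t) =
       (r t - r t0) * (grad F (x t + \<rho> t *\<^sub>R w t) \<bullet> w t)"
    using choice[of "\<lambda>t \<rho>. \<bar>\<rho> - r t0\<bar> \<le> \<bar>r t - r t0\<bar> \<and>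
      F (x t + r t *\<^sub>R w t) - F (x t + r t0 *\<^sub>R w t) =
        (r t - r t0) * (grad F (x t + \<rho> *\<^sub>R w t) \<bullet> w t)"] radial_mean_value by blast
  have "((\<lambda>t. \<rho> t - r t0) \<longlongrightarrow> 0) (at t0)"
    using cr by (intro Lim_null_comparison[OF _ tendsto_rabs_zero[OF LIM_zero[OF cr]]]) (simp add: \<rho>(1))
  then have "(\<rho> \<longlongrightarrow> r t0) (at t0)" by (simp add: LIM_zero_iff)
  then have D: "((\<lambda>t. grad F (x t + \<rho> t *\<^sub>R w t) \<bullet> w t) \<longlongrightarrow> grad F (x t0 + r t0 *\<^sub>R w t0) \<bullet> w t0) (at t0)"
    using cx cw by (intro tendsto_inner isCont_tendsto_compose[OF isCont_grad] tendsto_add tendsto_scaleR)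
      (auto simp: isCont_def)
  have D0: "grad F (x t0 + r t0 *\<^sub>R w t0) \<bullet> w t0 > 0"
    using at0 w0 by (intro chord_end_grad_pos)
  define E where "E = grad F (x t0 + r t0 *\<^sub>R w t0) \<bullet> (x' + r t0 *\<^sub>R w')"
  have "((\<lambda>t. F (x t + r t0 *\<^sub>R w t)) has_real_derivative E) (at t0)"
    unfolding E_def by (intro fun_along_curve smooth) (auto intro!: derivative_eq_intros x w)
  then have "((\<lambda>t. F (x t + r t0 *\<^sub>R w t) / (t - t0)) \<longlongrightarrow> E) (at t0)"
    by (simp add: has_field_derivative_iff at0)
  then have lim: "((\<lambda>t. - (F (x t + r t0 *\<^sub>R w t) / (t - t0)) / (grad F (x t + \<rho> t *\<^sub>R w t) \<bullet> w t)) \<longlongrightarrow>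
      - E / (grad F (x t0 + r t0 *\<^sub>R w t0) \<bullet> w t0)) (at t0)"
    using D D0 by (intro tendsto_divide tendsto_minus) auto
  have "\<forall>\<^sub>F t in at t0. F (x t) = 0 \<and> r t > 0 \<and> F (x t + r t *\<^sub>R w t) = 0"
    using r by (simp add: eventually_at_filter eventually_mono)
  with order_tendstoD(1)[OF D D0]
  have "\<forall>\<^sub>F t in at t0. - (F (x t + r t0 *\<^sub>R w t) / (t - t0)) / (grad F (x t + \<rho> t *\<^sub>R w t) \<bullet> w t) =
      (r t - r t0) / (t - t0)"
  proof eventually_elim
    case (elim t)
    then show ?case using \<rho>(2)[of t] by (auto simp: divide_simps)
  qed
  from Lim_transform_eventually[OF lim this] show ?thesis
    by (auto simp: has_field_derivative_iff)
qed

lemma curve_with_velocity: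
  assumes p: "F p = 0" and q: "F q = 0" and "p \<noteq> q" and v: "grad F p \<bullet> v = 0"
  shows "\<exists>c. c 0 = p \<and> (\<forall>\<^sub>F t in nhds 0. F (c t) = 0) \<and> (c has_vector_derivative v) (at 0)"
proof -
  \<comment> \<open>Central projection of the line \<open>p + t v\<close> onto the hypersurface from the point \<open>q\<close>.\<close>
  define w where "w t = (p - q) + t *\<^sub>R v" for t :: real
  define r where "r t = (SOME r. r > 0 \<and> F (q + r *\<^sub>R w t) = 0)" for t
  define c where "c t = q + r t *\<^sub>R w t" for t
  have w0: "w 0 \<noteq> 0" using \<open>p \<noteq> q\<close> by (simp add: w_def)
  have dw: "(w has_vector_derivative v) (at t)" for t
    unfolding w_def by (rule has_vector_derivative_affine)
  have "\<forall>\<^sub>F t in nhds 0. \<exists>r>0. \<bar>r - 1\<bar> < 1 \<and> F (q + r *\<^sub>R w t) = 0"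
    using p q w0 has_vector_derivative_continuous[OF dw]
    by (intro chord_exists_near) (auto simp: w_def)
  then have r: "\<forall>\<^sub>F t in nhds 0. F q = 0 \<and> r t > 0 \<and> F (q + r t *\<^sub>R w t) = 0"
  proof eventually_elim
    case (elim t)
    then have "\<exists>r. r > 0 \<and> F (q + r *\<^sub>R w t) = 0" by auto
    from someI_ex[OF this] show ?case using q by (simp add: r_def)
  qed
  \<comment> \<open>\<open>SOME\<close> picks the expected value because \<open>p\<close> is the
    only further point of the hypersurface on its ray from \<open>q\<close>.\<close>
  have "r 0 = 1"
  proof (rule chord_unique[OF q w0])
    show "F (q + 1 *\<^sub>R w 0) = 0" using p by (simp add: w_def)
  qed (use eventually_nhds_x_imp_x[OF r] in auto)
  obtain r' where r': "(r has_real_derivative r') (at 0)"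
    using chord_length_differentiable[OF _ dw w0 r, of 0] by auto
  have dc: "(c has_vector_derivative v + r' *\<^sub>R (p - q)) (at 0)"
    unfolding c_def using r' \<open>r 0 = 1\<close>
    by (auto intro!: derivative_eq_intros dw simp: w_def)
  have c0: "c 0 = p" using \<open>r 0 = 1\<close> by (simp add: c_def w_def)
  have ev: "\<forall>\<^sub>F t in nhds 0. F (c t) = 0" using r by (simp add: c_def eventually_mono)
  have "((\<lambda>t. F (c t)) has_real_derivative grad F p \<bullet> (v + r' *\<^sub>R (p - q))) (at 0)"
    using fun_along_curve[OF smooth dc] c0 by simp
  moreover have "((\<lambda>t. F (c t)) has_real_derivative 0) (at 0)"
    using ev DERIV_cong_ev[OF refl, of "\<lambda>t. F (c t)" "\<lambda>_. 0" 0 0 0] by simp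
  ultimately have "grad F p \<bullet> (v + r' *\<^sub>R (p - q)) = 0" by (rule DERIV_unique)
  \<comment> \<open>The velocity of a curve on the hypersurface is tangent. Since \<open>v\<close>
    is tangent and \<open>p - q\<close> is not, the radial correction \<open>r'\<close>
    vanishes.\<close>
  then have "r' * (grad F p \<bullet> (p - q)) = 0" using v by (simp add: inner_add_right inner_diff_right)
  moreover have "grad F p \<bullet> (q - p) < 0" using p q \<open>p \<noteq> q\<close> by (intro grad_inner_chord_neg) auto
  ultimately have "r' = 0" by (auto simp: inner_diff_right)
  with dc have "(c has_vector_derivative v) (at 0)" by simp
  with c0 ev show ?thesis by blast
qed

end

section \<open>Linear algebra of a chord\<close>

text \<open>Inclusion of half-spaces forces proportionality: every \<open>x\<close> is moved along
  \<open>e\<close> to where \<open>A\<close> equals \<open>- \<eta>\<close>, and \<eta> tends to 0.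
  The resulting inequality, used for \<open>x\<close> and \<open>- x\<close>, is an equality;
  \<open>a\<close> and \<open>b\<close> exclude zero functionals.\<close>

lemma proportional_functionals:
  fixes A B :: "'b::real_vector \<Rightarrow> real"
  assumes "linear A" "linear B" "subspace V"
    and le: "\<And>x. x \<in> V \<Longrightarrow> A x < 0 \<Longrightarrow> B x \<le> 0"
    and a: "a \<in> V" "A a \<noteq> 0" and b: "b \<in> V" "B b \<noteq> 0"
  shows "\<exists>\<mu>>0. \<forall>x\<in>V. A x = \<mu> * B x"
proof -
  interpret A: linear A by fact
  interpret B: linear B by fact
  define e where "e = a /\<^sub>R A a"
  have e: "e \<in> V" "A e = 1"
    using a \<open>subspace V\<close> by (auto simp: e_def subspace_scale A.scale)
  have upper: "B x \<le> A x * B e" if "x \<in> V" for x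
  proof (rule field_le_epsilon)
    fix \<epsilon> :: real assume "\<epsilon> > 0"
    define \<eta> where "\<eta> = \<epsilon> / (\<bar>B e\<bar> + 1)"
    have \<eta>: "\<eta> > 0" "\<eta> * B e \<le> \<epsilon>"
    proof -
      show "\<eta> > 0" using \<open>\<epsilon> > 0\<close> by (simp add: \<eta>_def add_nonneg_pos)
      have "\<eta> * B e \<le> \<eta> * (\<bar>B e\<bar> + 1)" using \<open>\<eta> > 0\<close> by (intro mult_left_mono) auto
      also have "\<dots> = \<epsilon>" by (simp add: \<eta>_def add_nonneg_eq_0_iff)
      finally show "\<eta> * B e \<le> \<epsilon>" .
    qed
    have "x - (A x + \<eta>) *\<^sub>R e \<in> V"
      using that e \<open>subspace V\<close> by (simp add: subspace_diff subspace_scale)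
    moreover have "A (x - (A x + \<eta>) *\<^sub>R e) = - \<eta>"
      using e by (simp add: A.diff A.scale)
    ultimately have "B (x - (A x + \<eta>) *\<^sub>R e) \<le> 0" using le \<eta> by simp
    then show "B x \<le> A x * B e + \<epsilon>" using \<eta> by (simp add: B.diff B.scale distrib_right)
  qed
  have eq: "B x = A x * B e" if "x \<in> V" for x
    using upper[OF that] upper[of "- x"] that \<open>subspace V\<close>
    by (simp add: subspace_neg A.neg B.neg)
  have "B (- e) \<le> 0" using le[of "- e"] e \<open>subspace V\<close> by (simp add: subspace_neg A.neg)
  then have "B e \<ge> 0" by (simp add: B.neg)
  moreover have "B e \<noteq> 0" using eq[OF b(1)] b(2) by auto
  ultimately show ?thesis using eq by (intro exI[of _ "1 / B e"]) auto
qed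

text \<open>The part of \<open>m\<close> orthogonal to \<open>N\<close> works: it vanishes only if
  \<open>m\<close> is a multiple of \<open>N\<close>, which \<open>z\<close> rules out, being
  orthogonal to \<open>m\<close> but not to \<open>N\<close>.\<close>

lemma exists_orthogonal_detecting:
  fixes m z N :: "'a::real_inner"
  assumes "m \<bullet> z = 0" "m \<noteq> 0" "N \<bullet> z \<noteq> 0" "N \<bullet> N = 1"
  shows "\<exists>w. w \<bullet> N = 0 \<and> w \<bullet> m \<noteq> 0"
proof -
  let ?w = "m - (m \<bullet> N) *\<^sub>R N"
  have wN: "?w \<bullet> N = 0" using assms by (simp add: inner_diff_left)
  have "?w \<noteq> 0"
  proof
    assume "?w = 0"
    then have m: "m = (m \<bullet> N) *\<^sub>R N" by simp
    then have "(m \<bullet> N) * (N \<bullet> z) = 0" using assms(1) by (metis inner_scaleR_left)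
    with assms m show False by (metis mult_eq_0_iff scale_zero_left)
  qed
  moreover have "?w \<bullet> ?w = ?w \<bullet> m" using wN by (simp add: inner_diff_right)
  ultimately have "?w \<bullet> m \<noteq> 0" by (metis inner_eq_zero_iff)
  with wN show ?thesis by blast
qed

lemma eq_scaleR_if_orthogonal:
  fixes x N :: "'a::real_inner"
  assumes "N \<bullet> N = 1" "\<And>w. w \<bullet> N = 0 \<Longrightarrow> w \<bullet> x = 0"
  shows "x = (x \<bullet> N) *\<^sub>R N"
proof -
  let ?w = "x - (x \<bullet> N) *\<^sub>R N"
  have "?w \<bullet> N = 0" using assms(1) by (simp add: inner_diff_left)
  with assms(2)[OF this] have "?w \<bullet> ?w = 0" by (simp add: inner_diff_right)
  then show ?thesis by simp
qed

text \<open>In the following two lemmas \<open>z\<close> is the direction and \<open>l\<close> the length of a chord from \<open>p\<close> to \<open>q\<close>; \<open>a\<close>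
  and \<open>b\<close> stand for the shape operators applied to \<open>u\<close> and \<open>U\<close>, \<open>z'\<close> for the derivative of \<open>z\<close> along
  the geodesic with velocity \<open>u\<close>, and \<open>q'\<close> for the resulting velocity of \<open>q\<close>.\<close>

lemma chord_endpoint_velocity:
  fixes z u n U N a q' :: "'a::real_inner"
  assumes "c \<noteq> 0" "s \<noteq> 0" "l \<noteq> 0" and cs: "c * c + s * s = 1"
    and un: "u \<bullet> u = 1" "n \<bullet> n = 1" "u \<bullet> n = 0" and z1: "z = c *\<^sub>R u + s *\<^sub>R n"
    and UN: "U \<bullet> U = 1" "N \<bullet> N = 1" "U \<bullet> N = 0" and z2: "z = c *\<^sub>R U - s *\<^sub>R N"
    and E1: "\<And>v. v \<bullet> n = 0 \<Longrightarrow> - (v \<bullet> (n - s *\<^sub>R z)) / l - c * (a \<bullet> v) = \<mu> * ((v \<bullet> (N + s *\<^sub>R z)) / l)"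
    and z': "z' = (c * (a \<bullet> u)) *\<^sub>R n + s *\<^sub>R ((a \<bullet> n) *\<^sub>R n - a)"
    and q': "q' = u + k *\<^sub>R z + l *\<^sub>R z'" and q'N: "q' \<bullet> N = 0"
  shows "q' = \<mu> *\<^sub>R U" "k = c * (\<mu> - 1)"
proof -
  define y where "y = (l * c) *\<^sub>R a"
  \<comment> \<open>Multiplied by \<open>- l\<close>, \<open>E1\<close> says that \<open>x\<close>
    is orthogonal to every \<open>v\<close> orthogonal to \<open>n\<close>. This expresses the shape
    operator term \<open>y\<close> through \<open>n\<close>, \<open>z\<close> and
    \<open>N\<close>.\<close>
  define x where "x = (n - s *\<^sub>R z) + y + \<mu> *\<^sub>R (N + s *\<^sub>R z)"
  have "x = (x \<bullet> n) *\<^sub>R n"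
  proof (rule eq_scaleR_if_orthogonal[OF un(2)])
    fix v assume "v \<bullet> n = 0"
    from E1[OF this] \<open>l \<noteq> 0\<close> show "v \<bullet> x = 0"
      by (simp add: x_def y_def inner_add_right inner_diff_right inner_commute[of a] field_simps)
  qed
  then obtain \<beta> where "x = \<beta> *\<^sub>R n" by blast
  then have y: "y = (\<beta> - 1) *\<^sub>R n + (s * (1 - \<mu>)) *\<^sub>R z - \<mu> *\<^sub>R N"
    by (simp add: x_def algebra_simps)
  have nz: "n \<bullet> z = s" using un by (simp add: z1 inner_add_right inner_commute)
  have Nz: "N \<bullet> z = - s" using UN by (simp add: z2 inner_diff_right inner_commute)
  have zz: "z \<bullet> z = 1" using un cs by (simp add: z1 inner_add_right inner_add_left inner_commute)
  have yz: "y \<bullet> z = \<beta> * s"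
    unfolding y by (simp add: inner_add_left inner_diff_left nz Nz zz algebra_simps)
  \<comment> \<open>After inserting \<open>z1\<close>, \<open>z'\<close> is
    \<open>(a \<bullet> z) *\<^sub>R n - s *\<^sub>R a\<close>; multiplied by \<open>c * l\<close>
    it involves \<open>a\<close> only through \<open>y\<close>.\<close>
  have lz': "(c * l) *\<^sub>R z' = (y \<bullet> z) *\<^sub>R n - s *\<^sub>R y"
    unfolding z' y_def z1 by (simp add: inner_add_right algebra_simps)
  define \<alpha> where "\<alpha> = 1 + c * k - s * s * (1 - \<mu>)"
  have "c *\<^sub>R q' = (z - s *\<^sub>R n) + (c * k) *\<^sub>R z + (c * l) *\<^sub>R z'"
    unfolding q' z1 by (simp add: algebra_simps)
  also have "\<dots> = \<alpha> *\<^sub>R z + (s * \<mu>) *\<^sub>R N"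
    unfolding lz' yz unfolding y \<alpha>_def by (simp add: algebra_simps)
  finally have cq': "c *\<^sub>R q' = \<alpha> *\<^sub>R z + (s * \<mu>) *\<^sub>R N" .
  \<comment> \<open>Tangency of \<open>q'\<close> at the far end fixes the unknown coefficient
    \<alpha>; then \<open>z + s *\<^sub>R N\<close> is recognized as
    \<open>c *\<^sub>R U\<close>.\<close>
  from arg_cong[OF this, of "\<lambda>t. t \<bullet> N"] have "s * \<alpha> = s * \<mu>"
    using q'N UN Nz[unfolded inner_commute[of N z]] by (auto simp: inner_add_left mult.commute)
  then have \<alpha>: "\<alpha> = \<mu>" using \<open>s \<noteq> 0\<close> by simp
  have "c *\<^sub>R q' = c *\<^sub>R (\<mu> *\<^sub>R U)" unfolding cq' \<alpha> z2 by (simp add: algebra_simps)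
  then show "q' = \<mu> *\<^sub>R U" using \<open>c \<noteq> 0\<close> unfolding scaleR_cancel_left by blast
  have "c * k = (\<mu> - 1) * (1 - s * s)" using \<alpha> by (simp add: \<alpha>_def algebra_simps)
  also have "1 - s * s = c * c" using cs by simp
  finally show "k = c * (\<mu> - 1)" using \<open>c \<noteq> 0\<close> by simp
qed

lemma chord_endpoint_acceleration:
  fixes z u n U N b q' :: "'a::real_inner"
  assumes "c \<noteq> 0" "l \<noteq> 0" and cs: "c * c + s * s = 1"
    and z1: "z = c *\<^sub>R u + s *\<^sub>R n" and "N \<bullet> N = 1" and z2: "z = c *\<^sub>R U - s *\<^sub>R N"
    and E2: "\<And>w. w \<bullet> N = 0 \<Longrightarrow> (w \<bullet> (n - s *\<^sub>R z)) / l = \<mu> * (c * (b \<bullet> w) - (w \<bullet> (N + s *\<^sub>R z)) / l)"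
    and q': "\<mu> *\<^sub>R U = u + k *\<^sub>R z + l *\<^sub>R z'" and k: "k = c * (\<mu> - 1)"
  shows "\<exists>\<kappa>. (1 / c) *\<^sub>R (z' + (s * \<mu>) *\<^sub>R ((b \<bullet> N) *\<^sub>R N - b)) = \<kappa> *\<^sub>R N"
proof -
  let ?x = "(1 / c) *\<^sub>R (z' + (s * \<mu>) *\<^sub>R ((b \<bullet> N) *\<^sub>R N - b))"
  have "?x = (?x \<bullet> N) *\<^sub>R N"
  proof (rule eq_scaleR_if_orthogonal[OF \<open>N \<bullet> N = 1\<close>])
    fix w assume w: "w \<bullet> N = 0"
    have wz1: "w \<bullet> z = c * (w \<bullet> u) + s * (w \<bullet> n)" by (simp add: z1 inner_add_right)
    have wz2: "w \<bullet> z = c * (w \<bullet> U)" using w by (simp add: z2 inner_diff_right)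
    \<comment> \<open>The velocity identity is paired with \<open>w\<close>. Eliminating
      \<open>u\<close> and \<open>U\<close> through \<open>z1\<close> and \<open>z2\<close> leaves a
      value of \<open>c * l * (w \<bullet> z')\<close>, and \<open>E2\<close> gives the same value
      for the shape operator term.\<close>
    have "\<mu> * (w \<bullet> U) = w \<bullet> u + k * (w \<bullet> z) + l * (w \<bullet> z')"
      using arg_cong[OF q', of "\<lambda>t. w \<bullet> t"] by (simp add: inner_add_right)
    then have "c * (\<mu> * (w \<bullet> U)) = c * (w \<bullet> u) + c * k * (w \<bullet> z) + c * l * (w \<bullet> z')"
      by (simp add: algebra_simps)
    then have "\<mu> * (w \<bullet> z) = (w \<bullet> z) - s * (w \<bullet> n) + (c * c) * (\<mu> - 1) * (w \<bullet> z) + c * l * (w \<bullet> z')"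
      using wz1 wz2 unfolding k by (simp add: algebra_simps)
    moreover have "c * c = 1 - s * s" using cs by simp
    ultimately have 1: "c * l * (w \<bullet> z') = s * (w \<bullet> n) + s * s * (\<mu> - 1) * (w \<bullet> z)"
      by (simp add: algebra_simps)
    have "w \<bullet> (n - s *\<^sub>R z) = \<mu> * (c * l * (b \<bullet> w) - w \<bullet> (N + s *\<^sub>R z))"
      using E2[OF w] \<open>l \<noteq> 0\<close> by (simp add: field_simps)
    then have "w \<bullet> n - s * (w \<bullet> z) = \<mu> * (c * l * (b \<bullet> w)) - \<mu> * s * (w \<bullet> z)"
      using w by (simp add: inner_diff_right inner_add_right algebra_simps)
    then have "c * l * (s * \<mu> * (b \<bullet> w)) = s * (w \<bullet> n) + s * s * (\<mu> - 1) * (w \<bullet> z)"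
      by algebra
    with 1 have "c * l * (w \<bullet> z') = c * l * (s * \<mu> * (b \<bullet> w))" by simp
    then have "w \<bullet> z' = s * \<mu> * (b \<bullet> w)" using \<open>c \<noteq> 0\<close> \<open>l \<noteq> 0\<close> by simp
    then show "w \<bullet> ?x = 0" using w by (simp add: inner_add_right inner_diff_right inner_commute)
  qed
  then show ?thesis by blast
qed

section \<open>Angles between chords and the hypersurface\<close>

text \<open>Up to a component along the normal this is the derivative of the outer unit normal. The
  projection to the tangent space is not built in, so terms
  \<open>(shape F p v \<bullet> n) *\<^sub>R n\<close> appear in the derivative formulas.\<close>

definition shape :: "('a::euclidean_space \<Rightarrow> real) \<Rightarrow> 'a \<Rightarrow> 'a \<Rightarrow> 'a" where
  "shape F p v = hess F p v /\<^sub>R norm (grad F p)"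

text \<open>The angle is measured at the first argument. There is no absolute value, which keeps it
  differentiable; strict convexity makes it positive between distinct points of the
  hypersurface.\<close>

definition chord_sine :: "('a::euclidean_space \<Rightarrow> real) \<Rightarrow> 'a \<Rightarrow> 'a \<Rightarrow> real" where
  "chord_sine F p q = ((q - p) \<bullet> inner_normal F p) / norm (q - p)"

lemma norm_along_curve:
  fixes d :: "real \<Rightarrow> 'a::real_inner"
  assumes "(d has_vector_derivative d') (at t)" "d t \<noteq> 0"
  shows "((\<lambda>t. norm (d t)) has_real_derivative (d t \<bullet> d') / norm (d t)) (at t)"
proof -
  have "((\<lambda>t. norm (d t)) has_derivative (\<lambda>h. (h *\<^sub>R d') \<bullet> sgn (d t))) (at t)"
    using has_derivative_compose[OF assms(1)[unfolded has_vector_derivative_def] has_derivative_norm[OF assms(2)]]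
    by simp
  moreover have "(\<lambda>h. (h *\<^sub>R d') \<bullet> sgn (d t)) = (*) ((d t \<bullet> d') / norm (d t))"
    by (auto simp: sgn_div_norm inner_commute divide_inverse algebra_simps)
  ultimately show ?thesis by (simp add: has_field_derivative_def)
qed

lemma inner_along_curve:
  fixes f g :: "real \<Rightarrow> 'a::real_inner"
  assumes "(f has_vector_derivative f') (at t)" "(g has_vector_derivative g') (at t)"
  shows "((\<lambda>t. f t \<bullet> g t) has_real_derivative f t \<bullet> g' + f' \<bullet> g t) (at t)"
  using bounded_bilinear.has_vector_derivative[OF bounded_bilinear_inner assms]
  by (simp add: has_real_derivative_iff_has_vector_derivative)

text \<open>The derivative of a unit vector field has no component along the field, so only the part
  of \<open>shape\<close> orthogonal to the normal survives, with a minus sign for the inner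
  normal.\<close>

lemma inner_normal_along_curve:
  assumes "smooth_fun F" "(c has_vector_derivative v) (at t)" "grad F (c t) \<noteq> 0"
  shows "((\<lambda>t. inner_normal F (c t)) has_vector_derivative
    (shape F (c t) v \<bullet> inner_normal F (c t)) *\<^sub>R inner_normal F (c t) - shape F (c t) v) (at t)"
proof -
  let ?g = "grad F (c t)" and ?h = "hess F (c t) v"
  note dg = grad_along_curve[OF assms(1,2)]
  have "((\<lambda>t. - (inverse (norm (grad F (c t))) *\<^sub>R grad F (c t))) has_vector_derivative
     - (inverse (norm ?g) *\<^sub>R ?h + (- (inverse (norm ?g) * ((?g \<bullet> ?h) / norm ?g) * inverse (norm ?g))) *\<^sub>R ?g)) (at t)"
    by (rule has_vector_derivative_minus has_vector_derivative_scaleR DERIV_inverse'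
        norm_along_curve[OF dg assms(3)] dg | (use assms(3) in simp; fail))+
  then show ?thesis
    unfolding inner_normal_def shape_def
    by (rule has_vector_derivative_eq_rhs) (simp add: algebra_simps inner_commute divide_inverse)
qed

context convex_table
begin

lemma shape_symmetric: "shape F p v \<bullet> w = shape F p w \<bullet> v"
  unfolding shape_def inner_scaleR_left by (subst hess_symmetric[OF smooth]) (rule refl)

lemma linear_shape: "linear (shape F p)"
  using linear_compose_scale_right[OF linear_hess[OF smooth]] by (simp add: shape_def[abs_def])

lemma grad_eq_inner_normal: "F p = 0 \<Longrightarrow> grad F p = - norm (grad F p) *\<^sub>R inner_normal F p"
  using grad_nonzero[of p] by (simp add: inner_normal_def)

lemma norm_inner_normal: "F p = 0 \<Longrightarrow> norm (inner_normal F p) = 1"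
  using grad_nonzero[of p] by (simp add: inner_normal_def)

lemma inner_normal_self: "F p = 0 \<Longrightarrow> inner_normal F p \<bullet> inner_normal F p = 1"
  using norm_inner_normal[of p] by (simp add: norm_eq_1)

lemma tangent_iff: "F p = 0 \<Longrightarrow> v \<bullet> inner_normal F p = 0 \<longleftrightarrow> grad F p \<bullet> v = 0"
  using grad_nonzero[of p] by (simp add: inner_normal_def inner_commute)

lemma inner_normal_sign: "F p = 0 \<Longrightarrow> 0 < v \<bullet> inner_normal F p \<longleftrightarrow> grad F p \<bullet> v < 0"
  using grad_nonzero[of p] by (simp add: inner_normal_def inner_commute mult_less_0_iff)

lemma chord_sine_pos:
  assumes "F p = 0" "F q = 0" "p \<noteq> q"
  shows "chord_sine F p q > 0"
  using grad_inner_chord_neg[of p q] assms by (simp add: chord_sine_def inner_normal_sign)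

lemma abs_chord_sine_le:
  assumes "F p = 0"
  shows "\<bar>chord_sine F p q\<bar> \<le> 1"
proof (cases "q = p")
  case False
  then show ?thesis
    using Cauchy_Schwarz_ineq2[of "q - p" "inner_normal F p"] norm_inner_normal[OF assms]
    by (simp add: chord_sine_def abs_divide)
qed (simp add: chord_sine_def)

lemma angle_hyperplane_eq:
  assumes "F p = 0" "F q = 0" "p \<noteq> q"
  shows "angle_hyperplane (q - p) (grad F p) = arcsin (chord_sine F p q)"
    and "angle_hyperplane (p - q) (grad F p) = arcsin (chord_sine F p q)"
proof -
  have neg: "grad F p \<bullet> (q - p) < 0" using grad_inner_chord_neg[of p q] assms by simp
  have abs1: "\<bar>(q - p) \<bullet> grad F p\<bar> = - ((q - p) \<bullet> grad F p)"
    using neg by (simp add: inner_commute)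
  have abs2: "\<bar>(p - q) \<bullet> grad F p\<bar> = - ((q - p) \<bullet> grad F p)"
    using neg by (simp add: inner_commute inner_diff_right)
  show "angle_hyperplane (q - p) (grad F p) = arcsin (chord_sine F p q)"
    unfolding angle_hyperplane_def abs1 chord_sine_def inner_normal_def
    by (simp add: divide_inverse mult_ac)
  show "angle_hyperplane (p - q) (grad F p) = arcsin (chord_sine F p q)"
    unfolding angle_hyperplane_def abs2 chord_sine_def inner_normal_def norm_minus_commute[of p q]
    by (simp add: divide_inverse mult_ac)
qed

text \<open>Quotient rule: the first summand comes from the moving chord, the second from the
  turning normal at \<open>c t\<close>.\<close>

lemma chord_sine_along_curves:
  assumes c: "(c has_vector_derivative v) (at t)" and d: "(d has_vector_derivative w) (at t)"
    and p: "F (c t) = 0" and "c t \<noteq> d t"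
    and z: "d t - c t = l *\<^sub>R z" "norm z = 1" "l > 0"
  shows "((\<lambda>t. chord_sine F (c t) (d t)) has_real_derivative
     ((w - v) \<bullet> (inner_normal F (c t) - (z \<bullet> inner_normal F (c t)) *\<^sub>R z)) / l +
     z \<bullet> ((shape F (c t) v \<bullet> inner_normal F (c t)) *\<^sub>R inner_normal F (c t) - shape F (c t) v)) (at t)"
proof -
  let ?n = "inner_normal F (c t)"
  let ?n' = "(shape F (c t) v \<bullet> ?n) *\<^sub>R ?n - shape F (c t) v"
  note dn = inner_normal_along_curve[OF smooth c grad_nonzero[OF p]]
  note dd = has_vector_derivative_diff[OF d c]
  have ne: "d t - c t \<noteq> 0" using \<open>c t \<noteq> d t\<close> by simp
  have "((\<lambda>t. chord_sine F (c t) (d t)) has_real_derivative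
     (((d t - c t) \<bullet> ?n' + (w - v) \<bullet> ?n) * norm (d t - c t) -
       ((d t - c t) \<bullet> ?n) * (((d t - c t) \<bullet> (w - v)) / norm (d t - c t))) /
         (norm (d t - c t) * norm (d t - c t))) (at t)"
    unfolding chord_sine_def using ne
    by (intro DERIV_divide inner_along_curve dd dn norm_along_curve) auto
  moreover have "(((d t - c t) \<bullet> ?n' + (w - v) \<bullet> ?n) * norm (d t - c t) -
       ((d t - c t) \<bullet> ?n) * (((d t - c t) \<bullet> (w - v)) / norm (d t - c t))) /
         (norm (d t - c t) * norm (d t - c t)) =
     ((w - v) \<bullet> (?n - (z \<bullet> ?n) *\<^sub>R z)) / l + z \<bullet> ?n'"
  proof -
    define y where "y = w - v"
    define n' where "n' = ?n'"
    show ?thesis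
      unfolding z(1) y_def[symmetric] n'_def[symmetric] using \<open>l > 0\<close> z(2)
      by (simp add: field_simps inner_diff_right inner_commute)
  qed
  ultimately show ?thesis by simp
qed

end

locale gutkin = convex_table F for F :: "'a::euclidean_space \<Rightarrow> real" +
  fixes \<delta> :: real
  assumes gutkin: "gutkin_table F \<delta>"
begin

lemma delta: "0 < \<delta>" "\<delta> < pi / 2"
  using gutkin by (auto simp: gutkin_table_def)

lemma sin_delta: "0 < sin \<delta>" "sin \<delta> < 1"
  using delta sin_gt_zero2 sin_monotone_2pi[of \<delta> "pi / 2"] by auto

lemma cos_delta: "0 < cos \<delta>"
  using delta by (intro cos_gt_zero_pi) auto

text \<open>The signs are known and the sines are at most 1, so \<open>arcsin\<close> can be
  inverted and the Gutkin property becomes a statement about signed sines.\<close>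

lemma chord_sine_swap:
  assumes "F p = 0" "F q = 0" "p \<noteq> q" "chord_sine F p q = sin \<delta>"
  shows "chord_sine F q p = sin \<delta>"
proof -
  have "angle_hyperplane (q - p) (grad F p) = \<delta>"
    using assms delta by (simp add: angle_hyperplane_eq arcsin_sin)
  then have "angle_hyperplane (q - p) (grad F q) = \<delta>"
    using gutkin assms unfolding gutkin_table_def by blast
  then have "arcsin (chord_sine F q p) = \<delta>"
    using angle_hyperplane_eq(2)[of q p] assms by simp
  then show ?thesis
    using abs_chord_sine_le[of q p] assms sin_arcsin[of "chord_sine F q p"] by (auto simp: abs_le_iff)
qed

end

section \<open>Comparison of the two angles of a chord\<close>

lemma isCont_inner_normal:
  assumes "smooth_fun F" "grad F x \<noteq> 0"
  shows "isCont (inner_normal F) x"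
  unfolding inner_normal_def[abs_def] using assms
    has_derivative_continuous[OF grad_has_derivative[OF assms(1)]]
  by (intro continuous_intros) auto

context gutkin
begin

text \<open>Turn the ray from \<open>p\<close> through \<open>q\<close> down to a tangent direction. Its second endpoint moves to \<open>p\<close>
  and the angle there tends to 0; since the angle at \<open>p\<close> stays below \<open>\<delta>\<close>, the angle at the second
  endpoint never equals \<open>\<delta>\<close>.\<close>

lemma chord_sine_less_swap:
  assumes p: "F p = 0" and q: "F q = 0" and "p \<noteq> q" and less: "chord_sine F p q < sin \<delta>"
  shows "chord_sine F q p < sin \<delta>"
proof (rule ccontr)
  assume "\<not> chord_sine F q p < sin \<delta>"
  then have ge: "sin \<delta> \<le> chord_sine F q p" by simp
  define n where "n = inner_normal F p"
  have nn: "n \<bullet> n = 1" using inner_normal_self[OF p] by (simp add: n_def)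
  define b where "b = (q - p) \<bullet> n"
  \<comment> \<open>\<open>u\<close> is the tangential part of \<open>q - p\<close>, and
    \<open>w \<tau>\<close> scales the normal part by \<tau>: \<open>w 1\<close> is the original
    chord and \<open>w 0\<close> is tangent.\<close>
  define u where "u = (q - p) - b *\<^sub>R n"
  define w where "w \<tau> = u + (\<tau> * b) *\<^sub>R n" for \<tau>
  have lpos: "norm (q - p) > 0" using \<open>p \<noteq> q\<close> by simp
  have b: "0 < b" "b < sin \<delta> * norm (q - p)"
    using chord_sine_pos[OF p q \<open>p \<noteq> q\<close>] less lpos
    by (auto simp: chord_sine_def b_def n_def zero_less_divide_iff divide_less_eq)
  have un: "u \<bullet> n = 0" by (simp add: u_def inner_diff_left nn b_def)
  have w1: "w 1 = q - p" by (simp add: w_def u_def)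
  have wn: "w \<tau> \<bullet> n = \<tau> * b" for \<tau> by (simp add: w_def inner_add_left un nn)
  have normw: "(norm (w \<tau>))\<^sup>2 = (norm u)\<^sup>2 + (\<tau> * b)\<^sup>2" for \<tau>
    using un nn unfolding power2_norm_eq_inner w_def
    by (simp add: inner_add_left inner_add_right inner_commute power2_eq_square)
  \<comment> \<open>Scaling the normal part by \<tau> leaves at least \<tau> times the length, hence
    the sine at \<open>p\<close> does not exceed its original value.\<close>
  have scale: "\<tau> * norm (q - p) \<le> norm (w \<tau>)" if "0 < \<tau>" "\<tau> \<le> 1" for \<tau>
  proof (rule power2_le_imp_le)
    have "\<tau>\<^sup>2 * (norm u)\<^sup>2 \<le> 1 * (norm u)\<^sup>2"
      using that by (intro mult_right_mono) (auto simp: power_le_one)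
    then show "(\<tau> * norm (q - p))\<^sup>2 \<le> (norm (w \<tau>))\<^sup>2"
      unfolding normw w1[symmetric] power_mult_distrib by (simp add: distrib_left power_mult_distrib)
  qed simp
  \<comment> \<open>A chord normal to the hypersurface at \<open>p\<close> would have sine 1 there,
    contrary to \<open>less\<close>.\<close>
  have u0: "u \<noteq> 0"
  proof
    assume "u = 0"
    with normw[of 1] have "(norm (q - p))\<^sup>2 = b\<^sup>2" by (simp add: w1)
    then have "norm (q - p) = b" by (rule power2_eq_imp_eq) (use b(1) in auto)
    moreover have "sin \<delta> * b < 1 * b" using sin_delta b(1) by (intro mult_strict_right_mono) auto
    ultimately show False using b(2) by simp
  qed
  have gradn: "grad F p = - norm (grad F p) *\<^sub>R n"
    using grad_eq_inner_normal[OF p] by (simp only: n_def)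
  have gradw: "grad F p \<bullet> w \<tau> = - (norm (grad F p) * (\<tau> * b))" for \<tau>
  proof -
    have "grad F p \<bullet> w \<tau> = (- norm (grad F p) *\<^sub>R n) \<bullet> w \<tau>" using gradn by (rule arg_cong)
    then show ?thesis using wn[of \<tau>] by (simp add: inner_commute[of n "w \<tau>"])
  qed
  have gpos: "norm (grad F p) > 0" using grad_nonzero[OF p] by simp
  define r where "r \<tau> = (SOME r. r > 0 \<and> F (p + r *\<^sub>R w \<tau>) = 0)" for \<tau>
  have r: "r \<tau> > 0" "F (p + r \<tau> *\<^sub>R w \<tau>) = 0" if "\<tau> > 0" for \<tau>
  proof -
    have "\<exists>r. r > 0 \<and> F (p + r *\<^sub>R w \<tau>) = 0"
      using ray_hits[OF p, of "w \<tau>"] that b gpos by (simp add: gradw)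
    from someI_ex[OF this] show "r \<tau> > 0" "F (p + r \<tau> *\<^sub>R w \<tau>) = 0" by (auto simp: r_def)
  qed
  have w0: "w \<tau> \<noteq> 0" if "\<tau> > 0" for \<tau> using wn[of \<tau>] that b by auto
  have contw: "isCont w \<tau>" for \<tau> unfolding w_def by (intro continuous_intros)
  have contr: "isCont r \<tau>" if "\<tau> > 0" for \<tau>
  proof (rule chord_length_isCont[OF _ contw w0[OF that], where x = "\<lambda>_. p"])
    show "\<forall>\<^sub>F t in nhds \<tau>. F p = 0 \<and> 0 < r t \<and> F (p + r t *\<^sub>R w t) = 0"
      using eventually_nhds_in_open[of "{0<..}" \<tau>] that
      by (auto elim!: eventually_mono simp: p r)
  qed simp
  define Q where "Q \<tau> = p + r \<tau> *\<^sub>R w \<tau>" for \<tau>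
  have Q: "F (Q \<tau>) = 0" "Q \<tau> \<noteq> p" if "\<tau> > 0" for \<tau>
    using r[OF that] w0[OF that] by (auto simp: Q_def)
  \<comment> \<open>The length factor \<open>r \<tau>\<close> has been cancelled from the sine at
    \<open>Q \<tau>\<close>, so this form still has a limit when the chord shrinks to a
    point.\<close>
  define \<psi> where "\<psi> \<tau> = - (w \<tau> \<bullet> inner_normal F (Q \<tau>)) / norm (w \<tau>)" for \<tau>
  have sine_Q: "chord_sine F (Q \<tau>) p = \<psi> \<tau>" if "\<tau> > 0" for \<tau>
    using r[OF that] by (simp add: chord_sine_def \<psi>_def Q_def)
  have sine_p: "chord_sine F p (Q \<tau>) < sin \<delta>" if "0 < \<tau>" "\<tau> \<le> 1" for \<tau>
  proof -
    have "\<tau> * b < \<tau> * (sin \<delta> * norm (q - p))" using b that by simp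
    also have "\<dots> = sin \<delta> * (\<tau> * norm (q - p))" by simp
    also have "\<dots> \<le> sin \<delta> * norm (w \<tau>)" using scale[OF that] sin_delta by simp
    finally show ?thesis
      using r[OF that(1)] w0[OF that(1)] wn[of \<tau>] by (simp add: chord_sine_def Q_def n_def divide_less_eq)
  qed
  have "r 1 = 1"
    by (rule chord_unique[OF p w0[of 1]]) (use r[of 1] q in \<open>auto simp: w1\<close>)
  then have "Q 1 = q" by (simp add: Q_def w1)
  then have psi1: "sin \<delta> \<le> \<psi> 1" using ge sine_Q[of 1] by simp
  have cont\<psi>: "isCont \<psi> \<tau>" if "\<tau> > 0" for \<tau>
  proof -
    have "isCont Q \<tau>" unfolding Q_def by (intro continuous_intros contr contw that)
    then have "isCont (\<lambda>\<tau>. inner_normal F (Q \<tau>)) \<tau>"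
      by (rule isCont_o2) (rule isCont_inner_normal[OF smooth grad_nonzero[OF Q(1)[OF that]]])
    then show ?thesis unfolding \<psi>_def using w0[OF that]
      by (intro continuous_intros contw) auto
  qed
  \<comment> \<open>Otherwise the intermediate value theorem gives a chord with angle \<delta> at
    its far end, hence by \<open>chord_sine_swap\<close> also at \<open>p\<close>, where the sine
    stays below \<open>sin \<delta>\<close>.\<close>
  have large: "sin \<delta> < \<psi> \<tau>" if "0 < \<tau>" "\<tau> \<le> 1" for \<tau>
  proof (rule ccontr)
    assume "\<not> sin \<delta> < \<psi> \<tau>"
    then have "\<exists>t\<ge>\<tau>. t \<le> 1 \<and> \<psi> t = sin \<delta>"
    proof (intro IVT psi1 that(2) allI impI)
      fix x assume "\<tau> \<le> x \<and> x \<le> 1"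
      then show "isCont \<psi> x" using that by (intro cont\<psi>) linarith
    qed linarith
    then obtain t where t: "\<tau> \<le> t" "t \<le> 1" "\<psi> t = sin \<delta>" by blast
    with that have "0 < t" by linarith
    then have "chord_sine F p (Q t) = sin \<delta>"
      using chord_sine_swap[OF Q(1) p Q(2)] sine_Q[of t] t by simp
    with sine_p[of t] t that show False by simp
  qed
  define \<tau> where "\<tau> k = 1 / real (Suc k)" for k
  have \<tau>: "0 < \<tau> k" "\<tau> k \<le> 1" for k by (auto simp: \<tau>_def)
  have \<tau>_lim: "\<tau> \<longlonglongrightarrow> 0" unfolding \<tau>_def by (rule LIMSEQ_inverse_real_of_nat[unfolded inverse_eq_divide])
  have "\<forall>k. Q (\<tau> k) \<in> {x. F x \<le> 0}" using Q \<tau> by simp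
  from seq_compactE[OF compact_body[unfolded compact_eq_seq_compact_metric] this]
  obtain L \<sigma> where \<sigma>: "strict_mono \<sigma>" "((\<lambda>k. Q (\<tau> k)) \<circ> \<sigma>) \<longlonglongrightarrow> L" by blast
  have QL: "(\<lambda>k. Q (\<tau> (\<sigma> k))) \<longlonglongrightarrow> L" using \<sigma>(2) by (simp add: o_def)
  have \<tau>\<sigma>: "(\<lambda>k. \<tau> (\<sigma> k)) \<longlonglongrightarrow> 0"
    using LIMSEQ_subseq_LIMSEQ[OF \<tau>_lim \<sigma>(1)] by (simp add: o_def)
  have "(\<lambda>k. F (Q (\<tau> (\<sigma> k)))) \<longlonglongrightarrow> F L" using isCont_F QL by (rule isCont_tendsto_compose)
  then have FL: "F L = 0" using Q(1)[OF \<tau>(1)] by (simp add: LIMSEQ_const_iff)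
  \<comment> \<open>The component of the chord along the normal at \<open>p\<close> is at most a
    constant times \<tau> times its length. In the limit \<open>L - p\<close> is tangent at
    \<open>p\<close>, and strict convexity leaves only \<open>L = p\<close>.\<close>
  have bound: "\<bar>grad F p \<bullet> (Q \<tau> - p)\<bar> \<le> norm (grad F p) * b / norm u * (\<tau> * norm (Q \<tau> - p))"
    if "\<tau> > 0" for \<tau>
  proof -
    have "norm u \<le> norm (w \<tau>)" using normw[of \<tau>] by (auto intro!: power2_le_imp_le[of "norm u"])
    then have "r \<tau> * norm u \<le> norm (Q \<tau> - p)" using r[OF that] by (simp add: Q_def)
    then have "r \<tau> \<le> norm (Q \<tau> - p) / norm u" using u0 by (simp add: field_simps)
    then have "norm (grad F p) * b * \<tau> * r \<tau> \<le> norm (grad F p) * b * \<tau> * (norm (Q \<tau> - p) / norm u)"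
      using b that by (intro mult_left_mono) auto
    moreover have "\<bar>grad F p \<bullet> (Q \<tau> - p)\<bar> = norm (grad F p) * b * \<tau> * r \<tau>"
      using r[OF that] b that by (simp add: Q_def gradw abs_mult)
    ultimately show ?thesis by (simp add: mult_ac)
  qed
  have lim1: "(\<lambda>k. \<bar>grad F p \<bullet> (Q (\<tau> (\<sigma> k)) - p)\<bar>) \<longlonglongrightarrow> \<bar>grad F p \<bullet> (L - p)\<bar>"
    by (intro tendsto_intros QL)
  have lim2: "(\<lambda>k. norm (grad F p) * b / norm u * (\<tau> (\<sigma> k) * norm (Q (\<tau> (\<sigma> k)) - p)))
      \<longlonglongrightarrow> norm (grad F p) * b / norm u * (0 * norm (L - p))"
    by (intro tendsto_mult tendsto_const \<tau>\<sigma> tendsto_norm tendsto_diff QL)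
  have "\<bar>grad F p \<bullet> (L - p)\<bar> \<le> norm (grad F p) * b / norm u * (0 * norm (L - p))"
    using lim1 lim2 by (rule LIMSEQ_le) (use bound[OF \<tau>(1)] in blast)
  then have "grad F p \<bullet> (L - p) = 0" by simp
  then have "L = p" using grad_inner_chord_neg[OF p, of L] FL by force
  \<comment> \<open>The limit direction \<open>w 0\<close> is tangent at \<open>p\<close>, so \<psi>
    tends to 0 along the subsequence although it stays above \<open>sin \<delta>\<close>.\<close>
  have "(\<lambda>k. w (\<tau> (\<sigma> k))) \<longlonglongrightarrow> w 0" using contw \<tau>\<sigma> by (rule isCont_tendsto_compose)
  moreover have "(\<lambda>k. inner_normal F (Q (\<tau> (\<sigma> k)))) \<longlonglongrightarrow> n"
    using isCont_tendsto_compose[OF isCont_inner_normal[OF smooth grad_nonzero[OF p]] QL[unfolded \<open>L = p\<close>]]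
    by (simp add: n_def)
  ultimately have "(\<lambda>k. \<psi> (\<tau> (\<sigma> k))) \<longlonglongrightarrow> - (w 0 \<bullet> n) / norm (w 0)"
    unfolding \<psi>_def using u0 by (intro tendsto_intros) (auto simp: w_def)
  then have "(\<lambda>k. \<psi> (\<tau> (\<sigma> k))) \<longlonglongrightarrow> 0" by (simp add: wn)
  then have "sin \<delta> \<le> 0"
    by (rule LIMSEQ_le_const) (use large[OF \<tau>] less_imp_le in blast)
  with sin_delta show False by simp
qed

text \<open>The angle is \<delta> at both ends, and \<open>chord_sine_less_swap\<close> relates the
  signs of the two variations. The resulting proportionality is read off separately for variations
  of \<open>p\<close> alone and of \<open>q\<close> alone.\<close>

lemma chord_variation:
  assumes p: "F p = 0" and q: "F q = 0" and l: "q - p = l *\<^sub>R z" "l > 0"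
    and n: "n = inner_normal F p" and N: "N = inner_normal F q"
    and u: "u \<bullet> u = 1" "u \<bullet> n = 0" and U: "U \<bullet> U = 1" "U \<bullet> N = 0"
    and z1: "z = cos \<delta> *\<^sub>R u + sin \<delta> *\<^sub>R n" and z2: "z = cos \<delta> *\<^sub>R U - sin \<delta> *\<^sub>R N"
  shows "\<exists>\<mu>>0.
    (\<forall>v. v \<bullet> n = 0 \<longrightarrow> - (v \<bullet> (n - sin \<delta> *\<^sub>R z)) / l - cos \<delta> * (shape F p u \<bullet> v) =
       \<mu> * ((v \<bullet> (N + sin \<delta> *\<^sub>R z)) / l)) \<and>
    (\<forall>w. w \<bullet> N = 0 \<longrightarrow> (w \<bullet> (n - sin \<delta> *\<^sub>R z)) / l =
       \<mu> * (cos \<delta> * (shape F q U \<bullet> w) - (w \<bullet> (N + sin \<delta> *\<^sub>R z)) / l))"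
proof -
  let ?c = "cos \<delta>" and ?s = "sin \<delta>"
  have nn: "n \<bullet> n = 1" "N \<bullet> N = 1" using inner_normal_self p q n N by auto
  have nz: "z \<bullet> n = ?s" using u nn by (simp add: z1 inner_add_left)
  have Nz: "z \<bullet> N = - ?s" using U nn by (simp add: z2 inner_diff_left)
  have zz: "z \<bullet> z = 1"
    using u nn sin_cos_squared_add3[of \<delta>] by (simp add: z1 inner_add_left inner_add_right inner_commute)
  then have z_norm: "norm z = 1" by (simp add: norm_eq_1)
  have z0: "z \<noteq> 0" using z_norm by auto
  have "p \<noteq> q" using l z0 by auto
  have norm_l: "norm (q - p) = l" "norm (p - q) = l"
    using l z_norm by (simp_all add: norm_minus_commute[of p q])
  have sp: "chord_sine F p q = ?s"
    using l nz z_norm by (simp add: chord_sine_def n[symmetric])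
  have pq: "p - q = l *\<^sub>R (- z)" using l by (metis minus_diff_eq scaleR_minus_right)
  have sq: "chord_sine F q p = ?s"
    unfolding chord_sine_def pq N[symmetric] using l Nz z_norm by simp
  \<comment> \<open>\<open>A\<close> and \<open>B\<close> are the differentials of the sines at
    \<open>p\<close> and at \<open>q\<close>, as functions of a pair of tangent velocities of the
    endpoints.\<close>
  define A where "A x = ((snd x - fst x) \<bullet> (n - ?s *\<^sub>R z)) / l - ?c * (shape F p u \<bullet> fst x)" for x :: "'a \<times> 'a"
  define B where "B x = ((fst x - snd x) \<bullet> (N + ?s *\<^sub>R z)) / l + ?c * (shape F q U \<bullet> snd x)" for x :: "'a \<times> 'a"
  define V where "V = {x :: 'a \<times> 'a. fst x \<bullet> n = 0 \<and> snd x \<bullet> N = 0}"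
  have "\<exists>\<mu>>0. \<forall>x\<in>V. A x = \<mu> * B x"
  proof -
    have lin: "linear A" "linear B"
      unfolding A_def B_def
      by (auto intro!: linearI simp: inner_add_left inner_add_right inner_diff_left algebra_simps
          add_divide_distrib diff_divide_distrib)
    have V: "subspace V" by (auto simp: V_def subspace_def inner_add_left)
    have le: "B x \<le> 0" if x: "x \<in> V" and neg: "A x < 0" for x
    proof -
      obtain v w where vw: "x = (v, w)" by fastforce
      have vn: "v \<bullet> n = 0" and wN: "w \<bullet> N = 0" using x by (auto simp: V_def vw)
      obtain c where c: "c 0 = p" "\<forall>\<^sub>F t in nhds 0. F (c t) = 0" "(c has_vector_derivative v) (at 0)"
        using curve_with_velocity[OF p q \<open>p \<noteq> q\<close>, of v] vn tangent_iff[OF p] n by auto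
      obtain d where d: "d 0 = q" "\<forall>\<^sub>F t in nhds 0. F (d t) = 0" "(d has_vector_derivative w) (at 0)"
        using curve_with_velocity[OF q p, of w] \<open>p \<noteq> q\<close> wN tangent_iff[OF q] N by auto
      have "((\<lambda>t. chord_sine F (c t) (d t)) has_real_derivative
         ((w - v) \<bullet> (n - (z \<bullet> n) *\<^sub>R z)) / l + z \<bullet> ((shape F p v \<bullet> n) *\<^sub>R n - shape F p v)) (at 0)"
        using chord_sine_along_curves[OF c(3) d(3), of l z] c(1) d(1) p \<open>p \<noteq> q\<close> l z_norm n by simp
      \<comment> \<open>Symmetry moves the shape operator from \<open>v\<close> to \<open>u\<close>;
        the normal part of \<open>z\<close> contributes nothing.\<close>
      moreover have "z \<bullet> ((shape F p v \<bullet> n) *\<^sub>R n - shape F p v) = - (?c * (shape F p u \<bullet> v))"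
        using u nn unfolding shape_symmetric[of p u v] z1
        by (simp add: inner_add_left inner_add_right inner_diff_right inner_commute algebra_simps)
      ultimately have dA: "((\<lambda>t. chord_sine F (c t) (d t)) has_real_derivative A x) (at 0)"
        using nz by (simp add: A_def vw)
      have "((\<lambda>t. chord_sine F (d t) (c t)) has_real_derivative
         ((v - w) \<bullet> (N - ((- z) \<bullet> N) *\<^sub>R (- z))) / l + (- z) \<bullet> ((shape F q w \<bullet> N) *\<^sub>R N - shape F q w)) (at 0)"
        using chord_sine_along_curves[OF d(3) c(3), of l "- z"] c(1) d(1) q \<open>p \<noteq> q\<close> pq l(2) z_norm N by simp
      moreover have "z \<bullet> ((shape F q w \<bullet> N) *\<^sub>R N - shape F q w) = - (?c * (shape F q U \<bullet> w))"
        using U nn unfolding shape_symmetric[of q U w] z2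
        by (simp add: inner_diff_left inner_diff_right inner_commute algebra_simps)
      ultimately have dB: "((\<lambda>t. chord_sine F (d t) (c t)) has_real_derivative B x) (at 0)"
        using Nz by (simp add: B_def vw)
      \<comment> \<open>Otherwise a small motion along \<open>c\<close> and \<open>d\<close> would
        push the sine at \<open>p\<close> below and the sine at \<open>q\<close> above
        \<open>sin \<delta>\<close>.\<close>
      show "B x \<le> 0"
      proof (rule ccontr)
        assume "\<not> B x \<le> 0"
        then have "B x > 0" by simp
        from DERIV_pos_inc_right[OF dB this] c(1) d(1) sq
        obtain e1 where e1: "e1 > 0" "\<And>h. 0 < h \<Longrightarrow> h < e1 \<Longrightarrow> ?s < chord_sine F (d h) (c h)" by auto
        from DERIV_neg_dec_right[OF dA neg] c(1) d(1) sp
        obtain e2 where e2: "e2 > 0" "\<And>h. 0 < h \<Longrightarrow> h < e2 \<Longrightarrow> chord_sine F (c h) (d h) < ?s" by auto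
        have "\<forall>\<^sub>F t in nhds 0. c t \<noteq> d t"
        proof -
          have "((\<lambda>t. d t - c t) \<longlongrightarrow> q - p) (nhds 0)"
            using has_vector_derivative_continuous[OF c(3)] has_vector_derivative_continuous[OF d(3)] c(1) d(1)
            by (intro tendsto_diff) (auto simp: continuous_at tendsto_nhds_iff)
          from tendsto_imp_eventually_ne[OF this, of 0] \<open>p \<noteq> q\<close> show ?thesis
            by (auto elim: eventually_mono)
        qed
        with c(2) d(2) have "\<forall>\<^sub>F t in nhds 0. F (c t) = 0 \<and> F (d t) = 0 \<and> c t \<noteq> d t"
          by eventually_elim auto
        then obtain e3 where e3: "e3 > 0" "\<And>t. \<bar>t\<bar> < e3 \<Longrightarrow> F (c t) = 0 \<and> F (d t) = 0 \<and> c t \<noteq> d t"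
          unfolding eventually_nhds_metric by (auto simp: dist_real_def)
        define h where "h = min (min e1 e2) e3 / 2"
        have h: "0 < h" "h < e1" "h < e2" "\<bar>h\<bar> < e3"
          using e1(1) e2(1) e3(1) unfolding h_def by linarith+
        show False
          using chord_sine_less_swap[of "c h" "d h"] e3(2)[OF h(4)] e2(2)[OF h(1,3)] e1(2)[OF h(1,2)] by simp
      qed
    qed
    \<comment> \<open>Neither functional is zero on \<open>V\<close>: these two vectors are nonzero
      because \<open>?s < 1\<close>, and being orthogonal to \<open>z\<close> each is detected by a
      tangent vector at the opposite endpoint.\<close>
    have m: "(n - ?s *\<^sub>R z) \<bullet> z = 0" "(N + ?s *\<^sub>R z) \<bullet> z = 0"
      using nz Nz zz by (simp_all add: inner_add_left inner_diff_left inner_commute[of n z] inner_commute[of N z])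
    have m0: "n - ?s *\<^sub>R z \<noteq> 0" "N + ?s *\<^sub>R z \<noteq> 0"
    proof -
      have "(n - ?s *\<^sub>R z) \<bullet> n = 1 - ?s * ?s" "(N + ?s *\<^sub>R z) \<bullet> N = 1 - ?s * ?s"
        using nz Nz nn by (simp_all add: inner_add_left inner_diff_left)
      moreover have "?s * ?s < 1" using sin_delta mult_strict_mono[of ?s 1 ?s 1] by simp
      ultimately show "n - ?s *\<^sub>R z \<noteq> 0" "N + ?s *\<^sub>R z \<noteq> 0" by auto
    qed
    obtain w where w: "w \<bullet> N = 0" "w \<bullet> (n - ?s *\<^sub>R z) \<noteq> 0"
      using exists_orthogonal_detecting[OF m(1) m0(1), of N] Nz nn sin_delta by (auto simp: inner_commute)
    obtain v where v: "v \<bullet> n = 0" "v \<bullet> (N + ?s *\<^sub>R z) \<noteq> 0"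
      using exists_orthogonal_detecting[OF m(2) m0(2), of n] nz nn sin_delta by (auto simp: inner_commute)
    show ?thesis
    proof (rule proportional_functionals[OF lin V le])
      show "(0, w) \<in> V" "(v, 0) \<in> V" using w v by (auto simp: V_def)
      show "A (0, w) \<noteq> 0" using w l by (simp add: A_def)
      show "B (v, 0) \<noteq> 0" using v l by (simp add: B_def)
    qed
  qed
  then obtain \<mu> where \<mu>: "\<mu> > 0" "\<And>x. x \<in> V \<Longrightarrow> A x = \<mu> * B x" by blast
  have "- (v \<bullet> (n - ?s *\<^sub>R z)) / l - ?c * (shape F p u \<bullet> v) = \<mu> * ((v \<bullet> (N + ?s *\<^sub>R z)) / l)"
    if "v \<bullet> n = 0" for v
    using \<mu>(2)[of "(v, 0)"] that by (simp add: A_def B_def V_def)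
  moreover have "(w \<bullet> (n - ?s *\<^sub>R z)) / l = \<mu> * (?c * (shape F q U \<bullet> w) - (w \<bullet> (N + ?s *\<^sub>R z)) / l)"
    if "w \<bullet> N = 0" for w
    using \<mu>(2)[of "(0, w)"] that by (simp add: A_def B_def V_def)
  ultimately show ?thesis using \<mu>(1) by blast
qed

end

section \<open>Regular geodesics\<close>

text \<open>\<open>U\<close> is the unit tangent, \<open>f\<close> the speed and \<sigma> an arc
  length function. Reparametrizing by the inverse \<phi> of \<sigma> gives velocity
  \<open>U\<close>, whose derivative is normal; differentiability of \<open>f\<close> makes the
  curve twice differentiable in the original parameter.\<close>

lemma regular_geodesic_onI:
  fixes c U :: "real \<Rightarrow> 'a::euclidean_space"
  assumes J: "open J" "is_interval J" and Fc: "\<And>s. s \<in> J \<Longrightarrow> F (c s) = 0"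
    and dc: "\<And>s. s \<in> J \<Longrightarrow> (c has_vector_derivative f s *\<^sub>R U s) (at s)"
    and df: "\<And>s. s \<in> J \<Longrightarrow> (f has_real_derivative f' s) (at s)"
    and dU: "\<And>s. s \<in> J \<Longrightarrow> (U has_vector_derivative k s *\<^sub>R grad F (c s)) (at s)"
    and f: "\<And>s. s \<in> J \<Longrightarrow> f s > 0" and U: "\<And>s. s \<in> J \<Longrightarrow> norm (U s) = 1"
    and d\<sigma>: "\<And>s. s \<in> J \<Longrightarrow> (\<sigma> has_real_derivative f s) (at s)"
  shows "regular_geodesic_on F J c"
    and "\<And>s. s \<in> J \<Longrightarrow> vd c s = f s *\<^sub>R U s"
    and "\<And>s. s \<in> J \<Longrightarrow> vd (\<lambda>t. vd c t) s = (f s * k s) *\<^sub>R grad F (c s) + f' s *\<^sub>R U s"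
proof -
  show vdc: "vd c s = f s *\<^sub>R U s" if "s \<in> J" for s
    using dc[OF that] by (rule vector_derivative_at)
  have ddc: "((\<lambda>t. vd c t) has_vector_derivative (f s * k s) *\<^sub>R grad F (c s) + f' s *\<^sub>R U s) (at s)"
    if "s \<in> J" for s
  proof (rule has_vector_derivative_transform_within_open[OF _ J(1) that])
    show "((\<lambda>t. f t *\<^sub>R U t) has_vector_derivative (f s * k s) *\<^sub>R grad F (c s) + f' s *\<^sub>R U s) (at s)"
      using has_vector_derivative_scaleR[OF df[OF that] dU[OF that]] by simp
  qed (simp add: vdc)
  then show "vd (\<lambda>t. vd c t) s = (f s * k s) *\<^sub>R grad F (c s) + f' s *\<^sub>R U s" if "s \<in> J" for s
    using that by (intro vector_derivative_at)
  have C2: "C2_curve_on J c"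
    unfolding C2_curve_on_def using dc ddc by (auto simp: vector_derivative_works[symmetric] dest: differentiableI_vector)
  have \<sigma>_less: "\<sigma> s < \<sigma> t" if "s \<in> J" "t \<in> J" "s < t" for s t
  proof (rule DERIV_pos_imp_increasing[OF \<open>s < t\<close>])
    fix x assume "s \<le> x" "x \<le> t"
    then have "x \<in> J" using J(2) that unfolding is_interval_1 by blast
    then show "\<exists>y. DERIV \<sigma> x :> y \<and> y > 0" using d\<sigma> f by blast
  qed
  have inj: "inj_on \<sigma> J"
    by (rule inj_onI) (metis \<sigma>_less linorder_neqE_linordered_idom order_less_irrefl)
  have cont: "isCont \<sigma> s" if "s \<in> J" for s using d\<sigma>[OF that] by (rule DERIV_isCont)
  then have cont_on: "continuous_on J \<sigma>" by (simp add: continuous_at_imp_continuous_on)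
  define J' where "J' = \<sigma> ` J"
  define \<phi> where "\<phi> = inv_into J \<sigma>"
  have \<phi>: "\<phi> (\<sigma> s) = s" if "s \<in> J" for s using inj that by (simp add: \<phi>_def)
  have \<phi>_in: "\<phi> t \<in> J" "\<sigma> (\<phi> t) = t" if "t \<in> J'" for t
    using that \<phi> by (auto simp: J'_def)
  have bij: "bij_betw \<phi> J' J" unfolding \<phi>_def J'_def
    using inj by (intro bij_betw_inv_into) (simp add: bij_betw_def)
  have openJ': "open J'"
    using injective_eq_1d_open_map_UNIV[OF cont_on J(2)] inj J(1) by (auto simp: J'_def)
  have intJ': "is_interval J'"
    using J(2) cont_on unfolding J'_def is_interval_connected_1
    by (intro connected_continuous_image)
  have d\<phi>: "(\<phi> has_real_derivative inverse (f (\<phi> t))) (at t)" if t: "t \<in> J'" for t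
  proof -
    obtain e where e: "e > 0" "cball (\<phi> t) e \<subseteq> J"
      using J(1) \<phi>_in(1)[OF t] by (auto simp: open_contains_cball)
    have "isCont \<phi> (\<sigma> (\<phi> t))"
    proof (rule isCont_inverse_function[OF e(1), where f = \<sigma>])
      fix z assume "\<bar>z - \<phi> t\<bar> \<le> e"
      then have "z \<in> J" using e(2) by (auto simp: dist_real_def subset_iff abs_minus_commute)
      then show "\<phi> (\<sigma> z) = z" "isCont \<sigma> z" by (auto simp: \<phi> cont)
    qed
    then have "isCont \<phi> t" using \<phi>_in(2)[OF t] by simp
    obtain d where d: "d > 0" "ball t d \<subseteq> J'" using openJ' t by (auto simp: open_contains_ball)
    show ?thesis
    proof (rule DERIV_inverse_function[where f = \<sigma> and a = "t - d" and b = "t + d"])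
      show "DERIV \<sigma> (\<phi> t) :> f (\<phi> t)" by (rule d\<sigma>[OF \<phi>_in(1)[OF t]])
      show "f (\<phi> t) \<noteq> 0" using f[OF \<phi>_in(1)[OF t]] by simp
      show "\<sigma> (\<phi> y) = y" if "t - d < y" "y < t + d" for y
        using that d(2) by (intro \<phi>_in) (auto simp: dist_real_def subset_iff)
    qed (use d(1) \<open>isCont \<phi> t\<close> in auto)
  qed
  have d\<phi>_pos: "\<exists>d>0. (\<phi> has_real_derivative d) (at t)" if "t \<in> J'" for t
    using d\<phi>[OF that] f[OF \<phi>_in(1)[OF that]] by (intro exI[of _ "inverse (f (\<phi> t))"]) auto
  have d\<phi>': "(\<phi> has_vector_derivative inverse (f (\<phi> t))) (at t)" if "t \<in> J'" for t
    using d\<phi>[OF that] by (simp add: has_real_derivative_iff_has_vector_derivative)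
  have dc\<phi>: "((c \<circ> \<phi>) has_vector_derivative U (\<phi> t)) (at t)" if "t \<in> J'" for t
    using vector_diff_chain_at[OF d\<phi>'[OF that] dc[OF \<phi>_in(1)[OF that]]] f[OF \<phi>_in(1)[OF that]] by simp
  then have vdc\<phi>: "vd (c \<circ> \<phi>) t = U (\<phi> t)" if "t \<in> J'" for t
    using that by (intro vector_derivative_at)
  have ddc\<phi>: "((\<lambda>t. vd (c \<circ> \<phi>) t) has_vector_derivative (inverse (f (\<phi> t)) * k (\<phi> t)) *\<^sub>R grad F ((c \<circ> \<phi>) t)) (at t)"
    if "t \<in> J'" for t
  proof (rule has_vector_derivative_transform_within_open[OF _ openJ' that])
    show "((U \<circ> \<phi>) has_vector_derivative (inverse (f (\<phi> t)) * k (\<phi> t)) *\<^sub>R grad F ((c \<circ> \<phi>) t)) (at t)"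
      using vector_diff_chain_at[OF d\<phi>'[OF that] dU[OF \<phi>_in(1)[OF that]]] by simp
  qed (simp add: vdc\<phi>)
  have "C2_curve_on J' (c \<circ> \<phi>)"
    unfolding C2_curve_on_def using dc\<phi> ddc\<phi>
    by (auto simp: vector_derivative_works[symmetric] dest: differentiableI_vector)
  moreover have "\<exists>a. vd (\<lambda>t. vd (c \<circ> \<phi>) t) t = a *\<^sub>R grad F ((c \<circ> \<phi>) t)" if "t \<in> J'" for t
    using vector_derivative_at[OF ddc\<phi>[OF that]] by blast
  ultimately have "geodesic_on F J' (c \<circ> \<phi>)"
    unfolding geodesic_on_def using openJ' intJ' \<phi>_in(1) Fc by simp
  moreover have "unit_speed_on J' (c \<circ> \<phi>)"
    unfolding unit_speed_on_def using vdc\<phi> U \<phi>_in(1) by simp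
  moreover have "vd c s \<noteq> 0" if "s \<in> J" for s
    using vdc[OF that] f[OF that] U[OF that] by auto
  ultimately show "regular_geodesic_on F J c"
    unfolding regular_geodesic_on_def using J C2 Fc bij d\<phi>_pos by blast
qed

lemma dim_span_triple_le_2:
  fixes x y z :: "'a::euclidean_space"
  assumes "x \<in> span {U, N}" "y \<in> span {U, N}" "z \<in> span {U, N}"
  shows "dim (span {x, y, z}) \<le> 2"
proof -
  have "dim (span {x, y, z}) \<le> dim (span {U, N})"
    using assms by (intro dim_subset span_minimal subspace_span) auto
  also have "\<dots> \<le> card {U, N}" by (simp add: dim_le_card')
  also have "\<dots> \<le> 2" by (simp add: card_insert_if)
  finally show ?thesis .
qed

text \<open>\<open>hess\<close> is known to be differentiable in the base point for a fixed vector,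
  so \<open>v s\<close> is first expanded in the standard basis.\<close>

lemma shape_along_curve_differentiable:
  assumes F: "smooth_fun F" and "grad F (c s) \<noteq> 0"
    and c: "(c has_vector_derivative c') (at s)" and v: "(v has_vector_derivative v') (at s)"
  shows "(\<lambda>s. shape F (c s) (v s)) differentiable (at s)"
proof -
  have dc: "c differentiable (at s)" and dv: "v differentiable (at s)"
    using c v by (auto intro: differentiableI_vector)
  have "(\<lambda>s. hess F (c s) b) differentiable (at s)" for b
    using differentiable_compose[OF differentiable_at_withinI[OF hess_differentiable[OF F]] dc] .
  then have "(\<lambda>s. \<Sum>b\<in>Basis. (v s \<bullet> b) *\<^sub>R hess F (c s) b) differentiable (at s)"
    using dv by (intro differentiable_sum differentiable_scaleR differentiable_inner) auto
  moreover have "(\<Sum>b\<in>Basis. (v s \<bullet> b) *\<^sub>R hess F (c s) b) = hess F (c s) (v s)" for s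
  proof -
    interpret linear "hess F (c s)" by (rule linear_hess[OF F])
    have "hess F (c s) (v s) = hess F (c s) (\<Sum>b\<in>Basis. (v s \<bullet> b) *\<^sub>R b)"
      by (simp add: euclidean_representation)
    then show ?thesis by (simp add: sum scale)
  qed
  ultimately have "(\<lambda>s. hess F (c s) (v s)) differentiable (at s)" by simp
  moreover have "(\<lambda>s. norm (grad F (c s))) differentiable (at s)"
    using norm_along_curve[OF grad_along_curve[OF F c] assms(2)] real_differentiable_def by blast
  ultimately show ?thesis
    unfolding shape_def using assms(2)
    by (intro differentiable_scaleR differentiable_inverse) auto
qed

section \<open>The image of a geodesic\<close>

lemma (in convex_table) tangent_if_on_table:
  assumes "open J" "s \<in> J" "\<And>t. t \<in> J \<Longrightarrow> F (c t) = 0" "(c has_vector_derivative v) (at s)"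
  shows "grad F (c s) \<bullet> v = 0"
proof -
  have "((\<lambda>t. F (c t)) has_real_derivative 0) (at s)"
  proof (rule has_field_derivative_transform_within_open[OF _ assms(1,2)])
    show "((\<lambda>_. 0) has_real_derivative 0) (at s)" by simp
  qed (simp add: assms(3))
  with fun_along_curve[OF smooth assms(4)] show ?thesis by (rule DERIV_unique)
qed

text \<open>Differentiating the tangency relation
  \<open>grad F (\<gamma> t) \<bullet> vd \<gamma> t = 0\<close> determines the factor left open by
  \<open>geodesic_on\<close>: it is the second fundamental form of the velocity.\<close>

lemma (in convex_table) geodesic_acceleration:
  assumes geod: "geodesic_on F J \<gamma>" and s: "s \<in> J"
  shows "vd (\<lambda>t. vd \<gamma> t) s =
    (shape F (\<gamma> s) (vd \<gamma> s) \<bullet> vd \<gamma> s) *\<^sub>R inner_normal F (\<gamma> s)"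
proof -
  let ?g = "grad F (\<gamma> s)" and ?u = "vd \<gamma> s" and ?u' = "vd (\<lambda>t. vd \<gamma> t) s"
  have J: "open J" and p: "\<And>t. t \<in> J \<Longrightarrow> F (\<gamma> t) = 0"
    and d: "\<And>t. t \<in> J \<Longrightarrow> (\<gamma> has_vector_derivative vd \<gamma> t) (at t)"
    and d2: "((\<lambda>t. vd \<gamma> t) has_vector_derivative ?u') (at s)"
    using geod s by (auto simp: geodesic_on_def C2_curve_on_def)
  obtain \<alpha> where \<alpha>: "?u' = \<alpha> *\<^sub>R ?g" using geod s by (auto simp: geodesic_on_def)
  have g0: "norm ?g \<noteq> 0" using grad_nonzero[OF p[OF s]] by simp
  have "((\<lambda>t. grad F (\<gamma> t) \<bullet> vd \<gamma> t) has_real_derivative 0) (at s)"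
  proof (rule has_field_derivative_transform_within_open[OF _ J s])
    show "((\<lambda>_. 0) has_real_derivative 0) (at s)" by simp
  qed (use tangent_if_on_table[OF J _ p d] in auto)
  moreover have "((\<lambda>t. grad F (\<gamma> t) \<bullet> vd \<gamma> t) has_real_derivative
      ?g \<bullet> ?u' + hess F (\<gamma> s) ?u \<bullet> ?u) (at s)"
    by (rule inner_along_curve[OF grad_along_curve[OF smooth d[OF s]] d2])
  ultimately have "?g \<bullet> ?u' + hess F (\<gamma> s) ?u \<bullet> ?u = 0" by (rule DERIV_unique[symmetric])
  then have h: "hess F (\<gamma> s) ?u \<bullet> ?u = - \<alpha> * (norm ?g)\<^sup>2"
    by (simp add: \<alpha> power2_norm_eq_inner)
  show ?thesis
    unfolding shape_def inner_normal_def inner_scaleR_left h \<alpha>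
    using g0 by (simp add: power2_eq_square)
qed

theorem theorem2p2:
  fixes F :: "'a::euclidean_space \<Rightarrow> real" and \<delta> :: real
    and J :: "real set" and \<gamma> \<Gamma> :: "real \<Rightarrow> 'a"
  assumes gutkin: "gutkin_table F \<delta>"
    and geod: "geodesic_on F J \<gamma>" and arclen: "unit_speed_on J \<gamma>"
    and Gamma: "\<forall>s\<in>J. F (\<Gamma> s) = 0 \<and>
        (\<exists>l>0. \<Gamma> s - \<gamma> s = l *\<^sub>R (cos \<delta> *\<^sub>R vd \<gamma> s + sin \<delta> *\<^sub>R inner_normal F (\<gamma> s)))"
  shows "regular_geodesic_on F J \<Gamma> \<and>
    (\<forall>s\<in>J. let z = cos \<delta> *\<^sub>R vd \<gamma> s + sin \<delta> *\<^sub>R inner_normal F (\<gamma> s) in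
        dim (span {z, vd \<Gamma> s, vd (\<lambda>t. vd \<Gamma> t) s}) \<le> 2 \<and>
        vec_angle (vd \<Gamma> s) z = \<delta>)"
proof -
  interpret gutkin F \<delta>
    using gutkin by unfold_locales (auto simp: gutkin_table_def)
  define cd where "cd = cos \<delta>"
  define sd where "sd = sin \<delta>"
  have cd: "cd > 0" and sd: "sd > 0" "sd < 1" and cs: "cd * cd + sd * sd = 1"
    using cos_delta sin_delta sin_cos_squared_add3[of \<delta>] by (auto simp: cd_def sd_def add.commute)
  have J: "open J" "is_interval J" and p: "\<And>s. s \<in> J \<Longrightarrow> F (\<gamma> s) = 0"
    using geod by (auto simp: geodesic_on_def)
  have q: "\<And>s. s \<in> J \<Longrightarrow> F (\<Gamma> s) = 0" using Gamma by blast
  define u where "u s = vd \<gamma> s" for s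
  define n where "n s = inner_normal F (\<gamma> s)" for s
  define N where "N s = inner_normal F (\<Gamma> s)" for s
  define z where "z s = cd *\<^sub>R u s + sd *\<^sub>R n s" for s
  \<comment> \<open>The candidate for the unit tangent of \<Gamma>: \<open>z s\<close> with its
    normal component at \<open>\<Gamma> s\<close> removed, as the Gutkin property will show, and
    rescaled.\<close>
  define U where "U s = (1 / cd) *\<^sub>R (z s + sd *\<^sub>R N s)" for s
  define l where "l s = norm (\<Gamma> s - \<gamma> s)" for s
  define a where "a s = shape F (\<gamma> s) (u s)" for s
  define zd where "zd s = (cd * (a s \<bullet> u s)) *\<^sub>R n s + sd *\<^sub>R ((a s \<bullet> n s) *\<^sub>R n s - a s)" for s
  \<comment> \<open>An explicit formula for the speed of \<Gamma>. Pairing the velocity with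
    \<open>U s - cd *\<^sub>R z s\<close>, which is orthogonal to \<open>z s\<close>, removes the
    derivative of \<open>l\<close>, so one derivative of \<open>l\<close> suffices to differentiate
    \<open>f\<close>. The pairing with \<open>U s\<close> is \<open>sd * sd\<close>.\<close>
  define f where "f s = (1 / (sd * sd)) * ((U s - cd *\<^sub>R z s) \<bullet> (u s + l s *\<^sub>R zd s))" for s

  \<comment> \<open>Derivatives of the frame along \<gamma>\<close>
  have d\<gamma>: "(\<gamma> has_vector_derivative u s) (at s)" if "s \<in> J" for s
    using geod that by (auto simp: geodesic_on_def C2_curve_on_def u_def)
  have du: "(u has_vector_derivative (a s \<bullet> u s) *\<^sub>R n s) (at s)" if "s \<in> J" for s
    using geod that geodesic_acceleration[OF geod that]
    by (auto simp: geodesic_on_def C2_curve_on_def u_def[abs_def] a_def n_def)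
  have dn: "(n has_vector_derivative (a s \<bullet> n s) *\<^sub>R n s - a s) (at s)" if "s \<in> J" for s
    using inner_normal_along_curve[OF smooth d\<gamma>[OF that] grad_nonzero[OF p[OF that]]]
    by (simp add: n_def[abs_def] a_def)
  have dz: "(z has_vector_derivative zd s) (at s)" if "s \<in> J" for s
  proof -
    have "((\<lambda>s. cd *\<^sub>R u s + sd *\<^sub>R n s) has_vector_derivative
        cd *\<^sub>R ((a s \<bullet> u s) *\<^sub>R n s) + sd *\<^sub>R ((a s \<bullet> n s) *\<^sub>R n s - a s)) (at s)"
      by (intro has_vector_derivative_add bounded_linear.has_vector_derivative[OF bounded_linear_scaleR_right]
          du dn that)
    then show ?thesis by (simp add: z_def[abs_def] zd_def)
  qed

  \<comment> \<open>Relations between the frames at the two endpoints\<close>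
  have uu: "u s \<bullet> u s = 1" if "s \<in> J" for s
    using arclen that by (simp add: unit_speed_on_def u_def norm_eq_1)
  have un: "u s \<bullet> n s = 0" if "s \<in> J" for s
    using tangent_if_on_table[OF J(1) that p d\<gamma>[OF that]] tangent_iff[OF p[OF that]] by (simp add: n_def)
  have nn: "n s \<bullet> n s = 1" "N s \<bullet> N s = 1" if "s \<in> J" for s
    using inner_normal_self p q that by (auto simp: n_def N_def)
  have nz: "z s \<bullet> n s = sd" if "s \<in> J" for s
    using un[OF that] nn[OF that] by (simp add: z_def inner_add_left)
  have zz: "z s \<bullet> z s = 1" if "s \<in> J" for s
    using uu[OF that] un[OF that] nn[OF that] cs
    by (simp add: z_def inner_add_left inner_add_right inner_commute)
  have z_norm: "norm (z s) = 1" if "s \<in> J" for s using zz[OF that] by (simp add: norm_eq_1)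
  have l: "l s > 0" "\<Gamma> s - \<gamma> s = l s *\<^sub>R z s" if s: "s \<in> J" for s
  proof -
    obtain r where r: "r > 0" "\<Gamma> s - \<gamma> s = r *\<^sub>R z s"
      using bspec[OF Gamma s] unfolding z_def u_def n_def cd_def sd_def by blast
    then have "l s = r" using z_norm[OF s] by (simp add: l_def)
    with r show "l s > 0" "\<Gamma> s - \<gamma> s = l s *\<^sub>R z s" by auto
  qed
  have \<Gamma>: "\<Gamma> s = \<gamma> s + l s *\<^sub>R z s" if "s \<in> J" for s using l(2)[OF that] by (simp add: algebra_simps)
  have Nz: "z s \<bullet> N s = - sd" if s: "s \<in> J" for s
  proof -
    have ne: "\<gamma> s \<noteq> \<Gamma> s" using l[OF s] z_norm[OF s] by auto
    have "chord_sine F (\<gamma> s) (\<Gamma> s) = sd"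
      using l[OF s] nz[OF s] z_norm[OF s] by (simp add: chord_sine_def n_def)
    then have "chord_sine F (\<Gamma> s) (\<gamma> s) = sd"
      using chord_sine_swap[OF p[OF s] q[OF s] ne] by (simp add: sd_def)
    moreover have "\<gamma> s - \<Gamma> s = l s *\<^sub>R (- z s)" using l(2)[OF s] by (simp add: algebra_simps)
    ultimately show ?thesis using l(1)[OF s] z_norm[OF s] by (simp add: chord_sine_def N_def)
  qed
  have UN: "U s \<bullet> N s = 0" if "s \<in> J" for s
    using Nz[OF that] nn[OF that] by (simp add: U_def inner_add_left)
  have zU: "z s = cd *\<^sub>R U s - sd *\<^sub>R N s" for s
    using cd by (simp add: U_def)
  have zUc: "z s \<bullet> U s = cd" if "s \<in> J" for s
  proof -
    have "z s \<bullet> U s = (1 - sd * sd) / cd"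
      using zz[OF that] Nz[OF that] by (simp add: U_def inner_add_right)
    also have "\<dots> = cd" using cs cd by (simp add: field_simps)
    finally show ?thesis .
  qed
  have UU: "U s \<bullet> U s = 1" if "s \<in> J" for s
  proof -
    have "cd = (cd *\<^sub>R U s - sd *\<^sub>R N s) \<bullet> U s" using zUc[OF that] zU[of s] by simp
    also have "\<dots> = cd * (U s \<bullet> U s)" using UN[OF that] by (simp add: inner_diff_left inner_commute[of "N s"])
    finally show ?thesis using cd by simp
  qed

  \<comment> \<open>Velocity of \<Gamma> and of its tangent direction\<close>
  have dl_ex: "\<exists>l'. (l has_real_derivative l') (at s)" if s: "s \<in> J" for s
  proof (rule chord_length_differentiable[OF d\<gamma>[OF s] dz[OF s]])
    show "z s \<noteq> 0" using z_norm[OF s] by auto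
    show "\<forall>\<^sub>F t in nhds s. F (\<gamma> t) = 0 \<and> 0 < l t \<and> F (\<gamma> t + l t *\<^sub>R z t) = 0"
      using eventually_nhds_in_open[OF J(1) s] by (rule eventually_mono) (simp add: p l \<Gamma>[symmetric] q)
  qed
  have step: "f s > 0 \<and> (l has_real_derivative cd * (f s - 1)) (at s) \<and>
      (\<Gamma> has_vector_derivative f s *\<^sub>R U s) (at s) \<and>
      (\<exists>\<kappa>. (U has_vector_derivative \<kappa> *\<^sub>R N s) (at s))" if s: "s \<in> J" for s
  proof -
    obtain l' where l': "(l has_real_derivative l') (at s)" using dl_ex[OF s] by blast
    define q' where "q' = u s + l' *\<^sub>R z s + l s *\<^sub>R zd s"
    have d\<Gamma>: "(\<Gamma> has_vector_derivative q') (at s)"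
    proof (rule has_vector_derivative_transform_within_open[OF _ J(1) s])
      show "((\<lambda>t. \<gamma> t + l t *\<^sub>R z t) has_vector_derivative q') (at s)"
        using has_vector_derivative_add[OF d\<gamma>[OF s] has_vector_derivative_scaleR[OF l' dz[OF s]]]
        by (simp add: q'_def algebra_simps)
    qed (simp add: \<Gamma>)
    have q'N: "q' \<bullet> N s = 0"
      using tangent_if_on_table[OF J(1) s q d\<Gamma>] tangent_iff[OF q[OF s]] by (simp add: N_def)
    obtain \<mu> where "\<mu> > 0"
      and E1: "\<And>v. v \<bullet> n s = 0 \<Longrightarrow> - (v \<bullet> (n s - sd *\<^sub>R z s)) / l s - cd * (a s \<bullet> v) =
        \<mu> * ((v \<bullet> (N s + sd *\<^sub>R z s)) / l s)"
      and E2: "\<And>w. w \<bullet> N s = 0 \<Longrightarrow> (w \<bullet> (n s - sd *\<^sub>R z s)) / l s =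
        \<mu> * (cd * (shape F (\<Gamma> s) (U s) \<bullet> w) - (w \<bullet> (N s + sd *\<^sub>R z s)) / l s)"
      using chord_variation[OF p[OF s] q[OF s] l(2,1)[OF s] n_def N_def uu[OF s] un[OF s] UU[OF s] UN[OF s]]
        z_def[of s] zU[of s]
      unfolding cd_def[symmetric] sd_def[symmetric] a_def[symmetric] by blast
    have ne: "cd \<noteq> 0" "sd \<noteq> 0" "l s \<noteq> 0" using cd sd l(1)[OF s] by auto
    have vel: "q' = \<mu> *\<^sub>R U s" "l' = cd * (\<mu> - 1)"
      by (rule chord_endpoint_velocity[OF ne cs uu[OF s] nn(1)[OF s] un[OF s] z_def UU[OF s] nn(2)[OF s]
        UN[OF s] zU E1 zd_def q'_def q'N]; assumption)+
    have "(U s - cd *\<^sub>R z s) \<bullet> (\<mu> *\<^sub>R U s) = (U s - cd *\<^sub>R z s) \<bullet> (u s + l s *\<^sub>R zd s)"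
    proof -
      have "(U s - cd *\<^sub>R z s) \<bullet> z s = 0"
        using zz[OF s] zUc[OF s] by (simp add: inner_diff_left inner_commute[of "U s"])
      then have "(U s - cd *\<^sub>R z s) \<bullet> q' = (U s - cd *\<^sub>R z s) \<bullet> (u s + l s *\<^sub>R zd s)"
        by (simp add: q'_def inner_add_right)
      then show ?thesis by (simp only: vel(1))
    qed
    moreover have "(U s - cd *\<^sub>R z s) \<bullet> (\<mu> *\<^sub>R U s) = \<mu> * (1 - cd * cd)"
      using UU[OF s] zUc[OF s] by (simp add: inner_diff_left)
    moreover have "1 - cd * cd = sd * sd" using cs by simp
    ultimately have f: "f s = \<mu>" using sd by (simp add: f_def)
    have dN: "(N has_vector_derivative \<mu> *\<^sub>R ((shape F (\<Gamma> s) (U s) \<bullet> N s) *\<^sub>R N s - shape F (\<Gamma> s) (U s))) (at s)"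
      using inner_normal_along_curve[OF smooth d\<Gamma>[unfolded vel(1)] grad_nonzero[OF q[OF s]]]
      by (simp add: N_def[abs_def] linear_cmul[OF linear_shape] algebra_simps)
    have dU: "(U has_vector_derivative (1 / cd) *\<^sub>R (zd s + (sd * \<mu>) *\<^sub>R
        ((shape F (\<Gamma> s) (U s) \<bullet> N s) *\<^sub>R N s - shape F (\<Gamma> s) (U s)))) (at s)"
    proof -
      have "((\<lambda>s. (1 / cd) *\<^sub>R (z s + sd *\<^sub>R N s)) has_vector_derivative (1 / cd) *\<^sub>R (zd s + sd *\<^sub>R (\<mu> *\<^sub>R
        ((shape F (\<Gamma> s) (U s) \<bullet> N s) *\<^sub>R N s - shape F (\<Gamma> s) (U s))))) (at s)"
        by (intro has_vector_derivative_add bounded_linear.has_vector_derivative[OF bounded_linear_scaleR_right]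
            dz[OF s] dN)
      then show ?thesis by (simp add: U_def[abs_def])
    qed
    have "\<exists>\<kappa>. (1 / cd) *\<^sub>R (zd s + (sd * \<mu>) *\<^sub>R
        ((shape F (\<Gamma> s) (U s) \<bullet> N s) *\<^sub>R N s - shape F (\<Gamma> s) (U s))) = \<kappa> *\<^sub>R N s"
      by (rule chord_endpoint_acceleration[OF ne(1,3) cs z_def nn(2)[OF s] zU E2 _ vel(2)])
        (simp_all add: vel(1)[symmetric] q'_def)
    with dU have "\<exists>\<kappa>. (U has_vector_derivative \<kappa> *\<^sub>R N s) (at s)" by metis
    with \<open>\<mu> > 0\<close> l' d\<Gamma> show ?thesis unfolding f vel(1) vel(2)[symmetric] by blast
  qed

  \<comment> \<open>Second derivatives of \<Gamma>, plane and angle\<close>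
  have df_ex: "\<exists>f'. (f has_real_derivative f') (at s)" if s: "s \<in> J" for s
  proof -
    have "a differentiable (at s)"
      unfolding a_def[abs_def]
      by (rule shape_along_curve_differentiable[OF smooth grad_nonzero[OF p[OF s]] d\<gamma>[OF s] du[OF s]])
    moreover have "u differentiable (at s)" "n differentiable (at s)" "z differentiable (at s)"
      "U differentiable (at s)" "l differentiable (at s)"
      using du[OF s] dn[OF s] dz[OF s] step[OF s]
      by (auto intro: differentiableI_vector simp: real_differentiable_def)
    ultimately have "f differentiable (at s)"
      unfolding f_def[abs_def] zd_def
      by (intro differentiable_mult differentiable_const differentiable_inner differentiable_diff
          differentiable_add differentiable_scaleR)
    then show ?thesis by (simp add: real_differentiable_def)
  qed
  then obtain f' where df: "\<And>s. s \<in> J \<Longrightarrow> (f has_real_derivative f' s) (at s)" by metis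
  have "\<exists>k. (U has_vector_derivative k *\<^sub>R grad F (\<Gamma> s)) (at s)" if s: "s \<in> J" for s
  proof -
    obtain \<kappa> where "(U has_vector_derivative \<kappa> *\<^sub>R N s) (at s)" using step[OF s] by blast
    then have "(U has_vector_derivative (- \<kappa> / norm (grad F (\<Gamma> s))) *\<^sub>R grad F (\<Gamma> s)) (at s)"
      by (simp add: N_def inner_normal_def divide_inverse)
    then show ?thesis by blast
  qed
  then obtain k where dU: "\<And>s. s \<in> J \<Longrightarrow> (U has_vector_derivative k s *\<^sub>R grad F (\<Gamma> s)) (at s)"
    by metis
  \<comment> \<open>The speed of \<open>\<Gamma>\<close> is \<open>1 + l' / cos \<delta>\<close>, so an arc length parameter is available explicitly.\<close>
  have d\<sigma>: "((\<lambda>s. s + l s / cd) has_real_derivative f s) (at s)" if s: "s \<in> J" for s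
    using step[OF s] cd by (auto intro!: derivative_eq_intros)
  note geo = regular_geodesic_onI[OF J q _ df dU _ _ d\<sigma>]
  have reg: "regular_geodesic_on F J \<Gamma>"
    and v1: "\<And>s. s \<in> J \<Longrightarrow> vd \<Gamma> s = f s *\<^sub>R U s"
    and v2: "\<And>s. s \<in> J \<Longrightarrow> vd (\<lambda>t. vd \<Gamma> t) s = (f s * k s) *\<^sub>R grad F (\<Gamma> s) + f' s *\<^sub>R U s"
    using step UU by (intro geo; simp add: norm_eq_1)+
  have "dim (span {z s, vd \<Gamma> s, vd (\<lambda>t. vd \<Gamma> t) s}) \<le> 2" if s: "s \<in> J" for s
  proof (rule dim_span_triple_le_2)
    have in_span: "U s \<in> span {U s, N s}" "N s \<in> span {U s, N s}" by (auto intro: span_base)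
    have g: "grad F (\<Gamma> s) \<in> span {U s, N s}"
      using grad_eq_inner_normal[OF q[OF s]] span_scale[OF in_span(2), of "- norm (grad F (\<Gamma> s))"]
      by (simp add: N_def)
    show "z s \<in> span {U s, N s}" unfolding zU by (intro span_diff span_scale in_span)
    show "vd \<Gamma> s \<in> span {U s, N s}" unfolding v1[OF s] by (intro span_scale in_span)
    show "vd (\<lambda>t. vd \<Gamma> t) s \<in> span {U s, N s}"
      unfolding v2[OF s] by (intro span_add span_scale in_span g)
  qed
  moreover have "vec_angle (vd \<Gamma> s) (z s) = \<delta>" if s: "s \<in> J" for s
  proof -
    \<comment> \<open>As \<open>f s\<close> is positive, the velocity has the direction of
      \<open>U s\<close>, whose inner product with the unit vector \<open>z s\<close> is
      \<open>cd\<close>.\<close>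
    have "vec_angle (vd \<Gamma> s) (z s) = arccos cd"
      using step[OF s] UU[OF s, folded norm_eq_1] z_norm[OF s] zUc[OF s]
      by (simp add: vec_angle_def v1[OF s] inner_commute)
    then show ?thesis using delta by (simp add: cd_def arccos_cos)
  qed
  ultimately show ?thesis
    using reg unfolding Let_def z_def u_def n_def cd_def sd_def by blast
qed

end
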